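(* Let $d,m\ge 1$, let $x_0\in\mathbb{R}^d$ be fixed, let $A\in\mathbb{R}^{d\times d}$ and $G\in\mathbb{R}^{d\times m}$, and assume that $A$ has $d$ distinct eigenvalues (in $\mathbb{C}$). Put $H:=GG^{\top}\in\mathbb{R}^{d\times d}$ and let $H_{\cdot j}$ denote the $j$-th column of $H$, $j=1,\dots,d$. Then the generator of the SDE $$dX_t=AX_t\,dt+G\,dW_t,\qquad X_0=x_0,\qquad 0\le t<\infty,$$ is identifiable from $x_0$ if and only if $$\operatorname{rank}\big([x_0\,|\,Ax_0\,|\cdots|\,A^{d-1}x_0\,|\,H_{\cdot 1}\,|\,AH_{\cdot 1}\,|\cdots|\,A^{d-1}H_{\cdot 1}\,|\cdots|\,H_{\cdot d}\,|\,AH_{\cdot d}\,|\cdots|\,A^{d-1}H_{\cdot d}]\big)=d .$$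
   Context: $W=\{W_t=[W_{1,t},\dots,W_{m,t}]^{\top}:0\le t<\infty\}$ is an $m$-dimensional standard Brownian motion on a filtered probability space. For $x_0\in\mathbb{R}^d$, $A\in\mathbb{R}^{d\times d}$, $G\in\mathbb{R}^{d\times m}$, the unique (strong) solution of $dX_t=AX_t\,dt+G\,dW_t$, $X_0=x_0$, is $$X(t;x_0,A,G)=e^{At}x_0+\int_0^t e^{A(t-s)}G\,dW_s,$$ and $X(\cdot;x_0,A,G)=\{X(t;x_0,A,G):0\le t<\infty\}$. For continuous processes, $X\overset{d}{=}\tilde X$ means that they have the same distribution on path space (equivalently, the same finite-dimensional distributions), and $\overset{d}{\neq}$ is the negation. Definition (identifiability). For $x_0\in\mathbb{R}^d$, $A\in\mathbb{R}^{d\times d}$, $G\in\mathbb{R}^{d\times m}$, the generator of the SDE $dX_t=AX_t\,dt+G\,dW_t$, $X_0=x_0$, is said to be identifiable from $x_0$ if for all $\tilde A\in\mathbb{R}^{d\times d}$ and all $\tilde G\in\mathbb{R}^{d\times m}$ with $(A,GG^{\top})\neq(\tilde A,\tilde G\tilde G^{\top})$, it holds that $X(\cdot;x_0,A,G)\overset{d}{\neq}X(\cdot;x_0,\tilde A,\tilde G)$. $[\,\cdot\,|\cdots|\,\cdot\,]$ denotes horizontal concatenation of columns. *)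

theory Defs
  imports "HOL-Probability.Probability"
begin

section \<open>Linear algebra\<close>

text \<open>Powers of a square matrix; the type class power \<open>A ^ k\<close> on \<open>real ^ 'n ^ 'n\<close> would be the
  componentwise one.\<close>

definition matpow :: "real ^ 'n ^ 'n \<Rightarrow> nat \<Rightarrow> real ^ 'n ^ 'n" where
  "matpow A k = (((**) A) ^^ k) (mat 1)"

definition complex_eigenvalues :: "real ^ 'n ^ 'n \<Rightarrow> complex set" where
  "complex_eigenvalues A =
     {z. \<exists>v :: complex ^ 'n. v \<noteq> 0 \<and> map_matrix complex_of_real A *v v = z *s v}"

text \<open>The matrix \<open>[x0 | A x0 | \<dots> | A^(d-1) x0 | H_1 | A H_1 | \<dots> | A^(d-1) H_d]\<close> with
  \<open>d = CARD('d)\<close> rows and \<open>(1 + d) d\<close> columns. A column is indexed by a block (\<open>Inl ()\<close> is the block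
  of \<open>x0\<close>, \<open>Inr j\<close> that of the \<open>j\<close>-th column of \<open>H\<close>) and by an element \<open>k\<close> of \<open>'d\<close> that encodes the
  exponent: \<open>to_nat_on UNIV\<close> is a bijection from \<open>'d\<close> onto \<open>{..<d}\<close>.\<close>

definition krylov_matrix ::
    "real ^ 'd ^ 'd \<Rightarrow> real ^ 'd \<Rightarrow> real ^ 'd ^ 'd \<Rightarrow> real ^ ((unit + 'd) \<times> 'd) ^ 'd" where
  "krylov_matrix A x0 H =
     (\<chi> i c. (matpow A (to_nat_on (UNIV :: 'd set) (snd c)) *v
               (case fst c of Inl _ \<Rightarrow> x0 | Inr j \<Rightarrow> column j H)) $ i)"

lemma columns_krylov_matrix:
  fixes A H :: "real ^ 'd ^ 'd"
  shows "columns (krylov_matrix A x0 H) =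
           {matpow A k *v x0 | k. k < CARD('d)} \<union>
           {matpow A k *v column j H | k j. k < CARD('d)}"
proof -
  have im: "to_nat_on (UNIV :: 'd set) ` UNIV = {..<CARD('d)}"
    using to_nat_on_finite[of "UNIV :: 'd set"] by (simp add: bij_betw_def)
  have lt: "to_nat_on (UNIV :: 'd set) e < CARD('d)" for e
    using im by blast
  have ex: "\<exists>e. k = to_nat_on (UNIV :: 'd set) e" if "k < CARD('d)" for k
    using im that by (metis imageE lessThan_iff)
  have col: "column (b, e) (krylov_matrix A x0 H) =
      matpow A (to_nat_on (UNIV :: 'd set) e) *v (case b of Inl _ \<Rightarrow> x0 | Inr j \<Rightarrow> column j H)" for b e
    by (simp add: krylov_matrix_def column_def vec_eq_iff)
  show ?thesis
  proof (intro subset_antisym subsetI)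
    fix v assume "v \<in> columns (krylov_matrix A x0 H)"
    then obtain b e where "v = column (b, e) (krylov_matrix A x0 H)"
      by (auto simp: columns_def)
    then show "v \<in> {matpow A k *v x0 | k. k < CARD('d)} \<union>
        {matpow A k *v column j H | k j. k < CARD('d)}"
      using lt[of e] by (cases b) (auto simp: col)
  next
    fix v assume "v \<in> {matpow A k *v x0 | k. k < CARD('d)} \<union>
        {matpow A k *v column j H | k j. k < CARD('d)}"
    then consider k where "k < CARD('d)" "v = matpow A k *v x0"
      | k j where "k < CARD('d)" "v = matpow A k *v column j H" by blast
    then show "v \<in> columns (krylov_matrix A x0 H)"
    proof cases
      case 1
      then obtain e where "v = column (Inl (), e) (krylov_matrix A x0 H)"
        using ex[of k] by (auto simp: col)
      then show ?thesis by (auto simp: columns_def)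
    next
      case 2
      then obtain e where "v = column (Inr j, e) (krylov_matrix A x0 H)"
        using ex[of k] by (auto simp: col)
      then show ?thesis by (auto simp: columns_def)
    qed
  qed
qed

section \<open>Brownian motion\<close>

text \<open>Time is \<open>{0..}\<close>; the values of filtrations and processes at negative times are irrelevant.\<close>

locale filtered_prob_space = prob_space M
  for M :: "'w measure" +
  fixes F :: "real \<Rightarrow> 'w measure"
  assumes subalgebra_F: "\<And>t. 0 \<le> t \<Longrightarrow> subalgebra M (F t)"
    and F_mono: "\<And>s t. 0 \<le> s \<Longrightarrow> s \<le> t \<Longrightarrow> sets (F s) \<subseteq> sets (F t)"

locale standard_brownian_motion = filtered_prob_space M F
  for M :: "'w measure" and F :: "real \<Rightarrow> 'w measure" +
  fixes W :: "real \<Rightarrow> 'w \<Rightarrow> real ^ 'm"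
  assumes adapted: "\<And>t. 0 \<le> t \<Longrightarrow> W t \<in> borel_measurable (F t)"
    and continuous_paths: "\<And>\<omega>. \<omega> \<in> space M \<Longrightarrow> continuous_on {0..} (\<lambda>t. W t \<omega>)"
    and start: "AE \<omega> in M. W 0 \<omega> = 0"
    and increment_indep: "\<And>s t. 0 \<le> s \<Longrightarrow> s < t \<Longrightarrow>
      indep_set (sets (F s)) {(\<lambda>\<omega>. W t \<omega> - W s \<omega>) -` B \<inter> space M | B. B \<in> sets borel}"
    and increment_components_indep: "\<And>s t. 0 \<le> s \<Longrightarrow> s < t \<Longrightarrow>
      indep_vars (\<lambda>_. borel) (\<lambda>i \<omega>. (W t \<omega> - W s \<omega>) $ i) UNIV"
    and increment_normal: "\<And>s t i. 0 \<le> s \<Longrightarrow> s < t \<Longrightarrow>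
      distributed M lborel (\<lambda>\<omega>. (W t \<omega> - W s \<omega>) $ i) (normal_density 0 (sqrt (t - s)))"

section \<open>The SDE \<open>dX = A X dt + G dW\<close>, \<open>X_0 = x0\<close>\<close>

text \<open>The integral form of the SDE. Since the diffusion coefficient \<open>G\<close> is constant, its Ito integral
  over \<open>[0, t]\<close> is \<open>G (W_t - W_0)\<close>, by the definition of the Ito integral of a simple integrand. The
  case \<open>t = 0\<close> of the equation is the initial condition.\<close>

definition strong_solution ::
    "'w measure \<Rightarrow> (real \<Rightarrow> 'w measure) \<Rightarrow> (real \<Rightarrow> 'w \<Rightarrow> real ^ 'm) \<Rightarrow>
     real ^ 'd \<Rightarrow> real ^ 'd ^ 'd \<Rightarrow> real ^ 'm ^ 'd \<Rightarrow> (real \<Rightarrow> 'w \<Rightarrow> real ^ 'd) \<Rightarrow> bool" where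
  "strong_solution M F W x0 A G X \<longleftrightarrow>
     (\<forall>t\<ge>0. X t \<in> borel_measurable (F t)) \<and>
     (\<forall>\<omega>\<in>space M. continuous_on {0..} (\<lambda>t. X t \<omega>)) \<and>
     (AE \<omega> in M. \<forall>t\<ge>0.
        X t \<omega> = x0 + integral {0..t} (\<lambda>s. A *v X s \<omega>) + G *v (W t \<omega> - W 0 \<omega>))"

text \<open>The process \<open>X(\<cdot>; x0, A, G)\<close>. For a standard Brownian motion \<open>W\<close> a strong solution exists (the
  linear integral equation is solved path by path), and any two strong solutions are
  indistinguishable, so that the law below does not depend on the choice.\<close>

definition sde_solution ::
    "'w measure \<Rightarrow> (real \<Rightarrow> 'w measure) \<Rightarrow> (real \<Rightarrow> 'w \<Rightarrow> real ^ 'm) \<Rightarrow>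
     real ^ 'd \<Rightarrow> real ^ 'd ^ 'd \<Rightarrow> real ^ 'm ^ 'd \<Rightarrow> (real \<Rightarrow> 'w \<Rightarrow> real ^ 'd)" where
  "sde_solution M F W x0 A G = (SOME X. strong_solution M F W x0 A G X)"

text \<open>The distribution on path space. The cylinder sigma-algebra of the product over \<open>{0..}\<close> is used;
  for continuous processes equality of these laws is equality of the laws on the space of continuous
  paths, whose Borel sigma-algebra is the trace of the cylinder sigma-algebra.\<close>

definition path_law :: "'w measure \<Rightarrow> (real \<Rightarrow> 'w \<Rightarrow> real ^ 'd) \<Rightarrow> (real \<Rightarrow> real ^ 'd) measure" where
  "path_law M X = distr M (\<Pi>\<^sub>M t\<in>{0..}. borel) (\<lambda>\<omega>. \<lambda>t\<in>{0..}. X t \<omega>)"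

definition generator_identifiable ::
    "'w measure \<Rightarrow> (real \<Rightarrow> 'w measure) \<Rightarrow> (real \<Rightarrow> 'w \<Rightarrow> real ^ 'm) \<Rightarrow>
     real ^ 'd \<Rightarrow> real ^ 'd ^ 'd \<Rightarrow> real ^ 'm ^ 'd \<Rightarrow> bool" where
  "generator_identifiable M F W x0 A G \<longleftrightarrow>
     (\<forall>(A' :: real ^ 'd ^ 'd) (G' :: real ^ 'm ^ 'd).
        (A, G ** transpose G) \<noteq> (A', G' ** transpose G') \<longrightarrow>
        path_law M (sde_solution M F W x0 A G) \<noteq> path_law M (sde_solution M F W x0 A' G'))"

end

theory Submission
  imports Defs
begin

text \<open>Write \<open>H = G G\<^sup>T\<close>. By linear algebra the rank condition says that \<open>w = 0\<close> is the only vector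
  with \<open>w\<^sup>T A\<^sup>k x0 = 0\<close> and \<open>w\<^sup>T A\<^sup>k G = 0\<close> for all \<open>k\<close> (lemma \<open>rank_krylov_matrix_full_iff\<close>).

  Necessity: let \<open>w \<noteq> 0\<close> be such a vector. The scalar processes \<open>w\<^sup>T A\<^sup>k X\<close> satisfy a closed
  homogeneous system of integral equations, so they vanish (\<open>volterra_orthogonal\<close>). Hence \<open>X\<close> also
  solves the equation with drift \<open>A + w w\<^sup>T\<close>, which differs from \<open>A\<close>, and the two parameter pairs
  produce the same law (\<open>rank_deficient_imp_same_law\<close>). Existence and pathwise uniqueness of strong
  solutions are needed to speak about "the" solution.

  Sufficiency: let \<open>X\<close> and \<open>Y\<close> solve the equations for \<open>(A, G)\<close> and \<open>(A', G')\<close> and have the same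
  law. The innovation \<open>X\<^sub>t - x0 - \<integral>\<^sub>0\<^sup>t A X\<close> equals \<open>G (W\<^sub>t - W\<^sub>0)\<close>, and \<open>X\<^sub>t - x0 - \<integral>\<^sub>0\<^sup>t A' X\<close> has
  the law of \<open>G' (W\<^sub>t - W\<^sub>0)\<close>, even jointly with the paths, since the same functional of \<open>Y\<close> is
  \<open>G' (W\<^sub>t - W\<^sub>0)\<close>. Both therefore are square integrable martingales with respect to the past of
  \<open>X\<close>. Their difference \<open>\<integral>\<^sub>0\<^sup>t (A' - A) X\<close> has Lipschitz paths, so it vanishes: this is the fact
  that a continuous martingale of bounded variation is constant, proved here directly from fourth
  moments (\<open>orthogonal_increments_lipschitz_constant\<close>). It follows that each row \<open>v\<^sup>T\<close> of \<open>A' - A\<close>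
  satisfies \<open>v\<^sup>T X = 0\<close>. Inserting this into the integral equation, the Brownian part \<open>v\<^sup>T G (W\<^sub>t - W\<^sub>0)\<close>
  has Lipschitz paths too, so \<open>v\<^sup>T G = 0\<close> by the same lemma, and then \<open>v\<^sup>T x0 = 0\<close> and
  \<open>v\<^sup>T A X = 0\<close>. By induction \<open>v\<close> is orthogonal to all \<open>A\<^sup>k x0\<close> and \<open>A\<^sup>k G\<close>
  (\<open>annihilator_orthogonal_krylov\<close>), and the rank condition gives \<open>v = 0\<close>. Thus \<open>A = A'\<close>, and
  comparing second moments of the innovation yields \<open>H = G' G'\<^sup>T\<close>.

  No moments of \<open>X\<close> itself and no matrix exponentials enter. Expressions like \<open>w\<^sup>T A\<close> are written
  \<open>w v* A\<close>.\<close>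

section \<open>Riemann sums and linear Volterra equations\<close>

lemma riemann_sum_tendsto_integral:
  fixes f :: "real \<Rightarrow> 'a::banach"
  assumes cont: "continuous_on {0..t} f" and "0 \<le> t"
  shows "(\<lambda>n. \<Sum>k<n. (t / real n) *\<^sub>R f (t * real k / real n)) \<longlonglongrightarrow> integral {0..t} f"
proof (rule LIMSEQ_I)
  fix r :: real assume "0 < r"
  define e where "e = r / (t + 1)"
  have "0 < e" using \<open>0 < r\<close> \<open>0 \<le> t\<close> by (simp add: e_def)
  have "uniformly_continuous_on {0..t} f"
    using cont compact_uniformly_continuous by blast
  then obtain \<delta> where \<delta>: "0 < \<delta>"
    "\<And>x y. x \<in> {0..t} \<Longrightarrow> y \<in> {0..t} \<Longrightarrow> dist y x < \<delta> \<Longrightarrow> dist (f y) (f x) < e"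
    unfolding uniformly_continuous_on_def using \<open>0 < e\<close> by metis
  obtain N :: nat where N: "t / \<delta> < real N" using reals_Archimedean2 by blast
  have "norm ((\<Sum>k<n. (t / real n) *\<^sub>R f (t * real k / real n)) - integral {0..t} f) < r"
    if "n \<ge> max N 1" for n
  proof -
    have n: "n > 0" using that by simp
    have "t / \<delta> < real n" using N that by simp
    then have mesh: "t / real n < \<delta>" using n \<delta>(1) by (simp add: field_simps)
    define p where "p k = t * real k / real n" for k
    have p_mono: "p k \<le> p l" if "k \<le> l" for k l
      unfolding p_def using that \<open>0 \<le> t\<close> n by (intro divide_right_mono mult_left_mono) auto
    have p_nn: "0 \<le> p k" for k unfolding p_def using \<open>0 \<le> t\<close> by simp
    have p_le: "p k \<le> t" if "k \<le> n" for k
      using p_mono[OF that] n by (simp add: p_def)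
    have p_step: "p (Suc k) - p k = t / real n" for k
      using n by (simp add: p_def field_simps)
    have int: "f integrable_on {a..b}" if "0 \<le> a" "b \<le> t" for a b
      using cont that by (intro integrable_continuous_real) (auto intro: continuous_on_subset)
    have split: "integral {0..p m} f = (\<Sum>k<m. integral {p k..p (Suc k)} f)" if "m \<le> n" for m
      using that
    proof (induction m)
      case 0
      then show ?case by (simp add: p_def)
    next
      case (Suc m)
      have "integral {0..p m} f + integral {p m..p (Suc m)} f = integral {0..p (Suc m)} f"
        using Suc.prems by (intro Henstock_Kurzweil_Integration.integral_combine p_nn p_mono int p_le) auto
      then show ?case using Suc by simp
    qed
    have piece: "norm ((t / real n) *\<^sub>R f (p k) - integral {p k..p (Suc k)} f) \<le> e * (t / real n)"
      if "k < n" for k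
    proof -
      have sub: "{p k..p (Suc k)} \<subseteq> {0..t}"
        using p_nn[of k] p_le[of "Suc k"] that by auto
      have c: "continuous_on {p k..p (Suc k)} f" using cont sub continuous_on_subset by blast
      have "integral {p k..p (Suc k)} (\<lambda>s. f (p k) - f s)
          = integral {p k..p (Suc k)} (\<lambda>s. f (p k)) - integral {p k..p (Suc k)} f"
        using c by (intro integral_diff) (auto intro: integrable_continuous_real)
      also have "integral {p k..p (Suc k)} (\<lambda>s. f (p k)) = (t / real n) *\<^sub>R f (p k)"
        using p_mono[of k "Suc k"] by (simp add: p_step)
      finally have eq: "(t / real n) *\<^sub>R f (p k) - integral {p k..p (Suc k)} f
          = integral {p k..p (Suc k)} (\<lambda>s. f (p k) - f s)" by simp
      have "norm (f (p k) - f s) \<le> e" if s: "s \<in> {p k..p (Suc k)}" for s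
      proof -
        have "dist (p k) s < \<delta>"
          using s p_step[of k] mesh by (auto simp: dist_real_def)
        then have "dist (f (p k)) (f s) < e"
          using \<delta>(2)[of s "p k"] s sub p_mono[of k "Suc k"] by force
        then show ?thesis by (simp add: dist_norm)
      qed
      then have "norm (integral {p k..p (Suc k)} (\<lambda>s. f (p k) - f s)) \<le> e * (p (Suc k) - p k)"
        by (intro integral_bound p_mono continuous_intros c) auto
      then show ?thesis by (simp add: eq p_step)
    qed
    have "norm ((\<Sum>k<n. (t / real n) *\<^sub>R f (p k)) - integral {0..t} f)
        = norm (\<Sum>k<n. (t / real n) *\<^sub>R f (p k) - integral {p k..p (Suc k)} f)"
      using split[of n] n by (simp add: p_def sum_subtractf)
    also have "\<dots> \<le> (\<Sum>k<n. e * (t / real n))"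
      by (intro sum_norm_le piece) auto
    also have "\<dots> = e * t" using n by simp
    also have "\<dots> < r"
      using \<open>0 < r\<close> \<open>0 \<le> t\<close> by (simp add: e_def field_simps)
    finally show ?thesis by (simp add: p_def)
  qed
  then show "\<exists>no. \<forall>n\<ge>no. norm ((\<Sum>k<n. (t / real n) *\<^sub>R f (t * real k / real n)) - integral {0..t} f) < r"
    by blast
qed

text \<open>One step of the iteration that bounds \<open>n\<close>-fold integrals by \<open>c t\<^sup>n / n!\<close>; it serves both
  uniqueness and the convergence of the Picard iterates below.\<close>

lemma norm_integral_le_power_fact:
  fixes f :: "real \<Rightarrow> 'a::banach"
  assumes cont: "continuous_on {0..t} f" and "0 \<le> t"
    and bound: "\<And>s. s \<in> {0..t} \<Longrightarrow> norm (f s) \<le> c * s ^ n / fact n"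
  shows "norm (integral {0..t} f) \<le> c * t ^ Suc n / fact (Suc n)"
proof -
  have "((\<lambda>s. c * s ^ n / fact n) has_integral
      c * t ^ Suc n / fact (Suc n) - c * 0 ^ Suc n / fact (Suc n)) {0..t}"
  proof (rule fundamental_theorem_of_calculus[OF \<open>0 \<le> t\<close>])
    fix s :: real
    have "((\<lambda>s. s ^ Suc n) has_real_derivative real (Suc n) * s ^ n) (at s within {0..t})"
      using DERIV_pow[of "Suc n" s "{0..t}"] by (simp only: diff_Suc_Suc diff_zero)
    then have "((\<lambda>s. c / fact (Suc n) * s ^ Suc n) has_real_derivative
        c / fact (Suc n) * (real (Suc n) * s ^ n)) (at s within {0..t})"
      by (rule DERIV_cmult)
    moreover have "c / fact (Suc n) * (real (Suc n) * s ^ n) = c * s ^ n / fact n"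
      by (simp add: divide_simps del: of_nat_Suc)
    ultimately have "((\<lambda>s. c * s ^ Suc n / fact (Suc n)) has_real_derivative c * s ^ n / fact n)
        (at s within {0..t})"
      by simp
    then show "((\<lambda>s. c * s ^ Suc n / fact (Suc n)) has_vector_derivative c * s ^ n / fact n)
        (at s within {0..t})"
      by (simp add: has_real_derivative_iff_has_vector_derivative)
  qed
  then have I: "((\<lambda>s. c * s ^ n / fact n) has_integral c * t ^ Suc n / fact (Suc n)) {0..t}" by simp
  have "norm (integral {0..t} f) \<le> integral {0..t} (\<lambda>s. c * s ^ n / fact n)"
    using I cont by (intro integral_norm_bound_integral bound) (auto intro: integrable_continuous_real)
  then show ?thesis by (simp only: integral_unique[OF I])
qed

lemma power_over_fact_tendsto_0:
  fixes x :: real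
  shows "(\<lambda>n. x ^ n / fact n) \<longlonglongrightarrow> 0"
  using summable_LIMSEQ_zero[OF summable_exp[of x]] by (simp add: field_simps)

lemma matrix_vector_norm_bound:
  fixes A :: "real ^ 'n ^ 'm"
  obtains K where "0 \<le> K" "\<And>v. norm (A *v v) \<le> K * norm v"
  using bounded_linear.nonneg_bounded[OF matrix_vector_mul_bounded_linear[of A]]
  by (metis mult.commute)

lemma inner_integral:
  fixes f :: "real \<Rightarrow> 'a::euclidean_space"
  assumes "continuous_on {0..t} f"
  shows "w \<bullet> integral {0..t} f = integral {0..t} (\<lambda>s. w \<bullet> f s)"
  using integral_linear[OF integrable_continuous_real[OF assms] bounded_linear_inner_right[of w]]
  by (simp add: o_def)

text \<open>A homogeneous linear Volterra equation, tested only against a set \<open>S\<close> of vectors that the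
  adjoint of \<open>A\<close> maps to itself, forces the solution to be orthogonal to \<open>S\<close>. With
  \<open>S = UNIV\<close> this is uniqueness for the integral equation; with a proper subspace it says that the
  solution does not leave the orthogonal complement of \<open>S\<close>.\<close>

lemma volterra_orthogonal:
  fixes X :: "real \<Rightarrow> real ^ 'd" and A :: "real ^ 'd ^ 'd"
  assumes cont: "continuous_on {0..} X"
    and closed: "\<And>w. w \<in> S \<Longrightarrow> w v* A \<in> S"
    and eq: "\<And>w t. w \<in> S \<Longrightarrow> 0 \<le> t \<Longrightarrow> w \<bullet> X t = integral {0..t} (\<lambda>s. (w v* A) \<bullet> X s)"
    and w: "w \<in> S" and t: "0 \<le> t"
  shows "w \<bullet> X t = 0"
proof -
  have contt: "continuous_on {0..t} X"
    using cont by (rule continuous_on_subset) auto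
  obtain K where K: "0 \<le> K" "\<And>v. norm (v v* A) \<le> K * norm v"
    using matrix_vector_norm_bound[of "transpose A"] by auto
  obtain c where c: "\<And>s. s \<in> {0..t} \<Longrightarrow> norm (X s) \<le> c"
    using compact_imp_bounded[OF compact_continuous_image[OF contt compact_Icc]]
    by (force simp: bounded_iff)
  have c0: "0 \<le> c" using order_trans[OF norm_ge_zero c[of 0]] t by simp
  have "norm (w \<bullet> X s) \<le> (norm w * c * K ^ n) * s ^ n / fact n"
    if "w \<in> S" "s \<in> {0..t}" for w s n
    using that
  proof (induction n arbitrary: w s)
    case 0
    have "norm (w \<bullet> X s) \<le> norm w * norm (X s)" by (simp add: Cauchy_Schwarz_ineq2)
    also have "\<dots> \<le> norm w * c" using c 0 by (intro mult_left_mono) auto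
    finally show ?case by simp
  next
    case (Suc n)
    have "norm (integral {0..s} (\<lambda>r. (w v* A) \<bullet> X r))
        \<le> (norm w * c * K ^ Suc n) * s ^ Suc n / fact (Suc n)"
    proof (rule norm_integral_le_power_fact)
      show "continuous_on {0..s} (\<lambda>r. (w v* A) \<bullet> X r)"
        using Suc.prems by (intro continuous_intros continuous_on_subset[OF contt]) auto
      show "0 \<le> s" using Suc.prems by simp
      fix r assume "r \<in> {0..s}"
      then have r: "r \<in> {0..t}" "0 \<le> r" using Suc.prems by auto
      have "norm ((w v* A) \<bullet> X r) \<le> (norm (w v* A) * c * K ^ n) * r ^ n / fact n"
        using Suc.IH closed Suc.prems r by blast
      also have "\<dots> \<le> ((K * norm w) * c * K ^ n) * r ^ n / fact n"
        using K c0 r by (intro divide_right_mono mult_right_mono) auto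
      finally show "norm ((w v* A) \<bullet> X r) \<le> (norm w * c * K ^ Suc n) * r ^ n / fact n"
        by (simp add: ac_simps)
    qed
    then show ?case using eq[of w s] Suc.prems by simp
  qed
  from this[of w t] have bound: "norm (w \<bullet> X t) \<le> (norm w * c) * ((K * t) ^ n / fact n)" for n
    using w t by (simp add: power_mult_distrib ac_simps)
  have "(\<lambda>n. (norm w * c) * ((K * t) ^ n / fact n)) \<longlonglongrightarrow> (norm w * c) * 0"
    by (intro tendsto_intros power_over_fact_tendsto_0)
  then have "norm (w \<bullet> X t) \<le> (norm w * c) * 0"
    by (rule LIMSEQ_le_const) (use bound in auto)
  then show ?thesis by simp
qed

lemma continuous_on_indefinite_integral:
  fixes f :: "real \<Rightarrow> 'a::euclidean_space"
  assumes "continuous_on {0..} f"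
  shows "continuous_on {0..} (\<lambda>t. integral {0..t} f)"
proof (subst continuous_on_eq_continuous_within, rule ballI)
  fix x :: real assume x: "x \<in> {0..}"
  have "continuous_on {0..x + 1} (\<lambda>t. integral {0..t} f)"
    by (intro indefinite_integral_continuous_1 integrable_continuous_real continuous_on_subset[OF assms]) auto
  then have "continuous (at x within {0..x + 1}) (\<lambda>t. integral {0..t} f)"
    using x by (auto simp: continuous_on_eq_continuous_within)
  moreover have "at x within {0..} = at x within {0..x + 1}"
    by (rule at_within_nhd[of _ "{..<x + 1}"]) auto
  ultimately show "continuous (at x within {0..}) (\<lambda>t. integral {0..t} f)"
    by (simp add: continuous_within)
qed

lemma integral_zero_imp_zero:
  fixes g :: "real \<Rightarrow> real"
  assumes cont: "continuous_on {0..} g" and zero: "\<And>t. 0 \<le> t \<Longrightarrow> integral {0..t} g = 0"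
    and t: "0 \<le> t"
  shows "g t = 0"
proof -
  have "((\<lambda>u. integral {0..u} g) has_vector_derivative g t) (at t within {0..t + 1})"
    using t by (intro integral_has_vector_derivative continuous_on_subset[OF cont]) auto
  moreover have "((\<lambda>u. integral {0..u} g) has_vector_derivative 0) (at t within {0..t + 1})"
    by (rule has_vector_derivative_transform[of _ _ _ "\<lambda>_. 0"])
      (use t zero in \<open>auto intro: derivative_eq_intros\<close>)
  ultimately show ?thesis
    using t by (intro vector_derivative_unique_within[of t "{0..t + 1}"])
      (auto simp: trivial_limit_within islimpt_Icc)
qed

lemma lipschitz_integral:
  fixes g :: "real \<Rightarrow> real"
  assumes cont: "continuous_on {0..} g"
  shows "\<exists>K. \<forall>s\<in>{0..T}. \<forall>t\<in>{0..T}. \<bar>integral {0..t} g - integral {0..s} g\<bar> \<le> K * \<bar>t - s\<bar>"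
proof -
  have "bounded (g ` {0..T})"
    by (intro compact_imp_bounded compact_continuous_image continuous_on_subset[OF cont]) auto
  then obtain K where K: "\<And>s. s \<in> {0..T} \<Longrightarrow> \<bar>g s\<bar> \<le> K"
    by (force simp: bounded_iff)
  have le: "\<bar>integral {0..t} g - integral {0..s} g\<bar> \<le> K * \<bar>t - s\<bar>"
    if st: "0 \<le> s" "s \<le> t" "t \<le> T" for s t
  proof -
    have c: "continuous_on {0..t} g" "continuous_on {s..t} g"
      by (rule continuous_on_subset[OF cont], use st in auto)+
    have "integral {0..s} g + integral {s..t} g = integral {0..t} g"
      using st c by (intro Henstock_Kurzweil_Integration.integral_combine integrable_continuous_real) auto
    moreover have "norm (integral {s..t} g) \<le> K * (t - s)"
      using st K by (intro integral_bound c) auto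
    ultimately show ?thesis using st by auto
  qed
  show ?thesis
  proof (intro exI ballI)
    fix s t assume "s \<in> {0..T}" "t \<in> {0..T}"
    then show "\<bar>integral {0..t} g - integral {0..s} g\<bar> \<le> K * \<bar>t - s\<bar>"
      using le[of s t] le[of t s] by (cases "s \<le> t") (auto simp: abs_minus_commute)
  qed
qed

text \<open>The fractions \<open>k / n\<close> are dense in \<open>{0..}\<close>. Since \<open>k / 0 = 0\<close>, the case \<open>n = 0\<close> only
  repeats the point \<open>0\<close>.\<close>

lemma zero_on_fractions_imp_zero:
  fixes g :: "real \<Rightarrow> real"
  assumes cont: "continuous_on {0..} g" and zero: "\<And>k n :: nat. g (real k / real n) = 0"
    and t: "0 \<le> t"
  shows "g t = 0"
proof -
  define r where "r n = real (nat \<lceil>t * real n\<rceil>) / real n" for n :: nat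
  have r: "t \<le> r n" "r n \<le> t + 1 / real n" if "0 < n" for n
  proof -
    have "real (nat \<lceil>t * real n\<rceil>) = of_int \<lceil>t * real n\<rceil>" using t by simp
    moreover have "t * real n \<le> of_int \<lceil>t * real n\<rceil>" "of_int \<lceil>t * real n\<rceil> \<le> t * real n + 1"
      by linarith+
    ultimately show "t \<le> r n" "r n \<le> t + 1 / real n"
      using that by (simp_all add: r_def field_simps)
  qed
  have "(\<lambda>n. t + 1 / real n) \<longlonglongrightarrow> t + 0" by (intro tendsto_intros lim_1_over_n)
  then have lim: "(\<lambda>n. t + 1 / real n) \<longlonglongrightarrow> t" by simp
  have "r \<longlonglongrightarrow> t"
    by (rule tendsto_sandwich[OF _ _ tendsto_const lim])
      (use r in \<open>auto intro!: eventually_sequentiallyI[of 1]\<close>)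
  moreover have "r n \<in> {0..}" for n by (simp add: r_def)
  ultimately have "(\<lambda>n. g (r n)) \<longlonglongrightarrow> g t"
    using cont t by (intro continuous_on_tendsto_compose[OF cont]) auto
  moreover have "g (r n) = 0" for n unfolding r_def by (rule zero)
  ultimately show ?thesis by (simp add: LIMSEQ_const_iff)
qed

text \<open>The Picard iterates of \<open>x t = b t + \<integral>\<^sub>0\<^sup>t A x\<close>.\<close>

primrec picard :: "real ^ 'd ^ 'd \<Rightarrow> (real \<Rightarrow> real ^ 'd) \<Rightarrow> nat \<Rightarrow> real \<Rightarrow> real ^ 'd" where
  "picard A b 0 = b"
| "picard A b (Suc n) = (\<lambda>t. b t + integral {0..t} (\<lambda>s. A *v picard A b n s))"

lemma continuous_on_picard:
  assumes "continuous_on {0..} b"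
  shows "continuous_on {0..} (picard A b n)"
proof (induction n)
  case (Suc n)
  have "continuous_on {0..} (\<lambda>s. A *v picard A b n s)"
    using Suc by (rule bounded_linear.continuous_on[OF matrix_vector_mul_bounded_linear])
  then show ?case
    by (simp add: continuous_on_add assms continuous_on_indefinite_integral)
qed (simp add: assms)

lemma picard_diff_bound:
  fixes A :: "real ^ 'd ^ 'd"
  assumes cont: "continuous_on {0..} b" and c: "\<And>s. s \<in> {0..t} \<Longrightarrow> norm (b s) \<le> c"
    and K: "0 \<le> K" "\<And>v. norm (A *v v) \<le> K * norm v"
    and s: "s \<in> {0..t}"
  shows "norm (picard A b (Suc n) s - picard A b n s) \<le> (c * K ^ Suc n) * s ^ Suc n / fact (Suc n)"
  using s
proof (induction n arbitrary: s)
  case 0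
  have "norm (integral {0..s} (\<lambda>r. A *v b r)) \<le> (c * K) * s ^ Suc 0 / fact (Suc 0)"
  proof (rule norm_integral_le_power_fact)
    show "continuous_on {0..s} (\<lambda>r. A *v b r)"
      by (intro bounded_linear.continuous_on[OF matrix_vector_mul_bounded_linear]
          continuous_on_subset[OF cont]) auto
    fix r assume "r \<in> {0..s}"
    then show "norm (A *v b r) \<le> (c * K) * r ^ 0 / fact 0"
      using K(2)[of "b r"] mult_left_mono[OF c[of r] K(1)] 0 by (simp add: mult.commute)
  qed (use 0 in auto)
  then show ?case by simp
next
  case (Suc n)
  have ct: "continuous_on {0..s} (\<lambda>r. A *v picard A b n r)" for n
    by (intro bounded_linear.continuous_on[OF matrix_vector_mul_bounded_linear]
          continuous_on_subset[OF continuous_on_picard[OF cont]]) auto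
  have "norm (integral {0..s} (\<lambda>r. A *v picard A b (Suc n) r - A *v picard A b n r))
      \<le> (c * K ^ Suc (Suc n)) * s ^ Suc (Suc n) / fact (Suc (Suc n))"
  proof (rule norm_integral_le_power_fact)
    show "continuous_on {0..s} (\<lambda>r. A *v picard A b (Suc n) r - A *v picard A b n r)"
      by (intro continuous_intros ct)
    fix r assume "r \<in> {0..s}"
    then have "norm (picard A b (Suc n) r - picard A b n r)
        \<le> (c * K ^ Suc n) * r ^ Suc n / fact (Suc n)"
      using Suc by auto
    then have "K * norm (picard A b (Suc n) r - picard A b n r)
        \<le> K * ((c * K ^ Suc n) * r ^ Suc n / fact (Suc n))"
      using K(1) by (rule mult_left_mono)
    moreover have "norm (A *v picard A b (Suc n) r - A *v picard A b n r)
        \<le> K * norm (picard A b (Suc n) r - picard A b n r)"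
      using K(2) by (metis matrix_vector_mult_diff_distrib)
    ultimately show "norm (A *v picard A b (Suc n) r - A *v picard A b n r)
        \<le> (c * K ^ Suc (Suc n)) * r ^ Suc n / fact (Suc n)"
      by (simp add: ac_simps del: picard.simps fact_Suc)
  qed (use Suc in auto)
  moreover have "picard A b (Suc (Suc n)) s - picard A b (Suc n) s
      = integral {0..s} (\<lambda>r. A *v picard A b (Suc n) r - A *v picard A b n r)"
    by (subst integral_diff)
      (use ct[of n] ct[of "Suc n"] in \<open>auto intro: integrable_continuous_real simp del: picard.simps(2) simp: picard.simps(2)[of A b "Suc n"] picard.simps(2)[of A b n, THEN fun_cong, of s]\<close>)
  ultimately show ?case by (simp only:)
qed

lemma picard_converges:
  fixes A :: "real ^ 'd ^ 'd"
  assumes cont: "continuous_on {0..} b"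
  obtains x where "continuous_on {0..} x"
    "\<And>t. 0 \<le> t \<Longrightarrow> (\<lambda>n. picard A b n t) \<longlonglongrightarrow> x t"
    "\<And>t. 0 \<le> t \<Longrightarrow> x t = b t + integral {0..t} (\<lambda>s. A *v x s)"
proof -
  define x where "x t = b t + (\<Sum>n. picard A b (Suc n) t - picard A b n t)" for t
  obtain K where K: "0 \<le> K" "\<And>v. norm (A *v v) \<le> K * norm v"
    using matrix_vector_norm_bound[of A] by auto
  have unif: "uniform_limit {0..T} (\<lambda>n t. picard A b n t) x sequentially" for T
  proof -
    have "bounded (b ` {0..T})"
      by (intro compact_imp_bounded compact_continuous_image continuous_on_subset[OF cont]) auto
    then obtain c where c: "\<And>s. s \<in> {0..T} \<Longrightarrow> norm (b s) \<le> c" "0 < c"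
      by (force simp: bounded_pos)
    have "uniform_limit {0..T} (\<lambda>n t. \<Sum>i<n. picard A b (Suc i) t - picard A b i t)
        (\<lambda>t. \<Sum>i. picard A b (Suc i) t - picard A b i t) sequentially"
    proof (rule Weierstrass_m_test)
      fix n t assume t: "t \<in> {0..T}"
      have "norm (picard A b (Suc n) t - picard A b n t)
          \<le> (c * K ^ Suc n) * t ^ Suc n / fact (Suc n)"
        by (rule picard_diff_bound[OF cont c(1) K t])
      also have "\<dots> \<le> (c * K ^ Suc n) * T ^ Suc n / fact (Suc n)"
        using t K(1) c(2) by (intro divide_right_mono mult_left_mono power_mono) auto
      finally show "norm (picard A b (Suc n) t - picard A b n t)
          \<le> c * ((K * T) ^ Suc n / fact (Suc n))"
        by (simp add: power_mult_distrib ac_simps del: picard.simps fact_Suc power_Suc)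
    next
      have "summable (\<lambda>n. (K * T) ^ n / fact n)"
        using summable_exp[of "K * T"] by (simp add: field_simps)
      then have "summable (\<lambda>n. (K * T) ^ Suc n / fact (Suc n))"
        by (subst summable_Suc_iff)
      then show "summable (\<lambda>n. c * ((K * T) ^ Suc n / fact (Suc n)))"
        by (rule summable_mult)
    qed
    then have "uniform_limit {0..T} (\<lambda>n t. b t + (\<Sum>i<n. picard A b (Suc i) t - picard A b i t)) x
        sequentially"
      unfolding x_def by (intro uniform_limit_intros)
    moreover have "b t + (\<Sum>i<n. picard A b (Suc i) t - picard A b i t) = picard A b n t" for n t
      by (subst sum_lessThan_telescope) simp
    ultimately show ?thesis by simp
  qed
  have cp: "continuous_on {0..T} (picard A b n)" for T n
    by (rule continuous_on_subset[OF continuous_on_picard[OF cont]]) auto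
  have cx: "continuous_on {0..T} x" for T
    by (rule uniform_limit_theorem[OF _ unif]) (auto intro!: cp always_eventually)
  have contx: "continuous_on {0..} x"
  proof (subst continuous_on_eq_continuous_within, rule ballI)
    fix t :: real assume t: "t \<in> {0..}"
    then have "continuous (at t within {0..t + 1}) x"
      using cx[of "t + 1"] by (auto simp: continuous_on_eq_continuous_within)
    moreover have "at t within {0..} = at t within {0..t + 1}"
      by (rule at_within_nhd[of _ "{..<t + 1}"]) auto
    ultimately show "continuous (at t within {0..}) x" by (simp add: continuous_within)
  qed
  have lim: "(\<lambda>n. picard A b n t) \<longlonglongrightarrow> x t" if "0 \<le> t" for t
    by (rule tendsto_uniform_limitI[OF unif[of t]]) (use that in auto)
  have "x t = b t + integral {0..t} (\<lambda>s. A *v x s)" if t: "0 \<le> t" for t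
  proof -
    have u: "uniform_limit {0..t} (\<lambda>n s. A *v picard A b n s) (\<lambda>s. A *v x s) sequentially"
      by (rule bounded_linear.uniform_limit[OF matrix_vector_mul_bounded_linear unif])
    obtain I J where IJ: "\<And>n. ((\<lambda>s. A *v picard A b n s) has_integral I n) {0..t}"
      "((\<lambda>s. A *v x s) has_integral J) {0..t}" "I \<longlonglongrightarrow> J"
      by (rule uniform_limit_integral[OF u])
        (auto intro: bounded_linear.continuous_on[OF matrix_vector_mul_bounded_linear] cp)
    then have "(\<lambda>n. b t + integral {0..t} (\<lambda>s. A *v picard A b n s))
        \<longlonglongrightarrow> b t + integral {0..t} (\<lambda>s. A *v x s)"
      by (intro tendsto_intros) (simp add: integral_unique[OF IJ(1)] integral_unique[OF IJ(2)])
    then have "(\<lambda>n. picard A b (Suc n) t) \<longlonglongrightarrow> b t + integral {0..t} (\<lambda>s. A *v x s)" by simp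
    moreover have "(\<lambda>n. picard A b (Suc n) t) \<longlonglongrightarrow> x t"
      using LIMSEQ_Suc[OF lim[OF t]] .
    ultimately show ?thesis using LIMSEQ_unique by blast
  qed
  then show ?thesis using that contx lim by blast
qed

section \<open>The Kalman rank condition\<close>

lemma matpow_0 [simp]: "matpow A 0 = mat 1"
  by (simp add: matpow_def)

lemma matpow_Suc: "matpow A (Suc k) = A ** matpow A k"
  by (simp add: matpow_def)

lemma matpow_Suc_right: "matpow A (Suc k) = matpow A k ** A"
proof (induction k)
  case (Suc k)
  then show ?case by (metis matpow_Suc matrix_mul_assoc)
qed (simp add: matpow_Suc)

text \<open>Higher powers of \<open>A\<close> add nothing to the span of \<open>x, A x, \<dots>, A\<^sup>d\<^sup>-\<^sup>1 x\<close>, where \<open>d\<close> is the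
  dimension. This dimension count replaces an appeal to the Cayley-Hamilton theorem.\<close>

lemma matpow_vector_in_span:
  fixes A :: "real ^ 'd ^ 'd"
  shows "matpow A k *v x \<in> span ((\<lambda>k. matpow A k *v x) ` {..<CARD('d)})"
proof -
  define v where "v k = matpow A k *v x" for k
  have v_Suc: "v (Suc k) = A *v v k" for k
    by (simp add: v_def matpow_Suc matrix_vector_mul_assoc)
  \<comment> \<open>The first exponent at which the sequence of spans stops growing is at most the dimension.\<close>
  have "\<exists>n\<le>CARD('d). v n \<in> span (v ` {..<n})"
  proof (rule ccontr)
    assume no: "\<not> (\<exists>n\<le>CARD('d). v n \<in> span (v ` {..<n}))"
    have "dim (v ` {..<n}) = n" if "n \<le> Suc CARD('d)" for n
      using that
    proof (induction n)
      case (Suc n)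
      then have "v n \<notin> span (v ` {..<n})" using no by auto
      then show ?case using Suc by (simp add: lessThan_Suc dim_insert)
    qed simp
    from this[of "Suc CARD('d)"] show False
      using dim_subset_UNIV[of "v ` {..<Suc CARD('d)}"] by simp
  qed
  then obtain n where n: "n \<le> CARD('d)" "v n \<in> span (v ` {..<n})" by blast
  let ?V = "span (v ` {..<n})"
  have inv: "A *v u \<in> ?V" if "u \<in> ?V" for u
  proof -
    have "A *v u \<in> (*v) A ` ?V" using that by blast
    also have "\<dots> = span ((*v) A ` v ` {..<n})"
      by (simp add: linear_span_image)
    also have "\<dots> \<subseteq> ?V"
    proof (rule span_minimal)
      show "(*v) A ` v ` {..<n} \<subseteq> ?V"
      proof (clarify)
        fix j assume j: "j < n"
        have "v (Suc j) \<in> ?V"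
          using j n(2) by (cases "Suc j = n") (auto intro: span_base)
        then show "A *v v j \<in> ?V" by (simp add: v_Suc)
      qed
    qed simp
    finally show ?thesis .
  qed
  have "v k \<in> ?V"
  proof (induction k)
    case 0
    then show ?case using n(2) by (cases "n = 0") (auto intro: span_base)
  next
    case (Suc k)
    then show ?case by (simp add: v_Suc inv)
  qed
  moreover have "?V \<subseteq> span (v ` {..<CARD('d)})"
    using n(1) by (intro span_mono image_mono) auto
  ultimately have "v k \<in> span (v ` {..<CARD('d)})" by blast
  then show ?thesis by (simp add: v_def)
qed

lemma orthogonal_matpow_vector:
  fixes A :: "real ^ 'd ^ 'd"
  assumes "\<And>k. k < CARD('d) \<Longrightarrow> w \<bullet> (matpow A k *v x) = 0"
  shows "w \<bullet> (matpow A k *v x) = 0"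
proof -
  have "orthogonal w (matpow A k *v x)"
    by (rule orthogonal_to_span[OF matpow_vector_in_span])
      (use assms in \<open>auto simp: orthogonal_def\<close>)
  then show ?thesis by (simp add: orthogonal_def)
qed

lemma vector_matrix_zero_iff_gram:
  fixes G :: "real ^ 'm ^ 'd"
  shows "u v* G = 0 \<longleftrightarrow> (\<forall>j. u \<bullet> column j (G ** transpose G) = 0)"
proof -
  have "u \<bullet> column j (G ** transpose G) = (u v* (G ** transpose G)) $ j" for j
    by (simp add: vector_matrix_mult_def column_def inner_vec_def mult.commute)
  then have "u \<bullet> column j (G ** transpose G) = ((u v* G) v* transpose G) $ j" for j
    by (simp only: vector_matrix_mul_assoc)
  then have "(\<forall>j. u \<bullet> column j (G ** transpose G) = 0) \<longleftrightarrow> G *v (u v* G) = 0"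
    by (simp add: vec_eq_iff)
  also have "\<dots> \<longleftrightarrow> u v* G = 0"
  proof
    assume "G *v (u v* G) = 0"
    then have "(u v* G) \<bullet> (u v* G) = 0"
      by (simp add: dot_lmul_matrix)
    then show "u v* G = 0" by simp
  qed simp
  finally show ?thesis by simp
qed

text \<open>The rank condition in dual form. The powers \<open>k \<ge> CARD('d)\<close> contribute nothing new, and the
  columns of \<open>G G\<^sup>T\<close> can be replaced by those of \<open>G\<close>.\<close>

lemma rank_krylov_matrix_full_iff:
  fixes A :: "real ^ 'd ^ 'd" and G :: "real ^ 'm ^ 'd"
  shows "rank (krylov_matrix A x0 (G ** transpose G)) = CARD('d) \<longleftrightarrow>
    (\<forall>w. (\<forall>k. (w v* matpow A k) \<bullet> x0 = 0 \<and> (w v* matpow A k) v* G = 0) \<longrightarrow> w = 0)"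
    (is "?rank \<longleftrightarrow> (\<forall>w. ?orth w \<longrightarrow> w = 0)")
proof -
  let ?H = "G ** transpose G"
  let ?C = "columns (krylov_matrix A x0 ?H)"
  have orth: "?orth w \<longleftrightarrow> (\<forall>c\<in>?C. w \<bullet> c = 0)" for w
  proof -
    have "?orth w \<longleftrightarrow> (\<forall>k. w \<bullet> (matpow A k *v x0) = 0) \<and>
        (\<forall>j k. w \<bullet> (matpow A k *v column j ?H) = 0)"
      unfolding vector_matrix_zero_iff_gram dot_lmul_matrix by blast
    also have "\<dots> \<longleftrightarrow> (\<forall>k<CARD('d). w \<bullet> (matpow A k *v x0) = 0) \<and>
        (\<forall>j. \<forall>k<CARD('d). w \<bullet> (matpow A k *v column j ?H) = 0)"
      using orthogonal_matpow_vector[of w A x0] orthogonal_matpow_vector[of w A "column j ?H" for j]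
      by blast
    also have "\<dots> \<longleftrightarrow> (\<forall>c\<in>?C. w \<bullet> c = 0)"
      unfolding columns_krylov_matrix by blast
    finally show ?thesis .
  qed
  have "?rank \<longleftrightarrow> dim ?C = DIM(real ^ 'd)"
    by (simp add: column_rank_def)
  also have "\<dots> \<longleftrightarrow> span ?C = UNIV"
    by (rule dim_eq_full)
  also have "\<dots> \<longleftrightarrow> (\<forall>w. (\<forall>c\<in>?C. w \<bullet> c = 0) \<longrightarrow> w = 0)"
  proof
    assume full: "span ?C = UNIV"
    show "\<forall>w. (\<forall>c\<in>?C. w \<bullet> c = 0) \<longrightarrow> w = 0"
    proof (intro allI impI)
      fix w assume "\<forall>c\<in>?C. w \<bullet> c = 0"
      then have "orthogonal w w"
        using full by (intro orthogonal_to_span[of w ?C]) (auto simp: orthogonal_def)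
      then show "w = 0" by (simp add: orthogonal_def)
    qed
  next
    assume trivial: "\<forall>w. (\<forall>c\<in>?C. w \<bullet> c = 0) \<longrightarrow> w = 0"
    show "span ?C = UNIV"
    proof (rule ccontr)
      assume "span ?C \<noteq> UNIV"
      then obtain w where "w \<noteq> 0" "\<forall>c\<in>span ?C. w \<bullet> c = 0"
        using span_not_UNIV_orthogonal by blast
      then show False using trivial by (meson span_base)
    qed
  qed
  finally show ?thesis by (simp only: orth)
qed

section \<open>Processes with orthogonal increments and Lipschitz paths\<close>

lemma power2_le_1_plus_power4: "(x::real)\<^sup>2 \<le> 1 + x ^ 4"
proof -
  have "0 \<le> (x\<^sup>2 - 1 / 2)\<^sup>2" by simp
  then show ?thesis by (simp add: power2_eq_square power4_eq_xxxx field_simps)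
qed

lemma power4_diff_le: "(a - b :: real) ^ 4 \<le> 8 * (a ^ 4 + b ^ 4)"
proof -
  have sq: "(x + y)\<^sup>2 \<le> 2 * (x\<^sup>2 + y\<^sup>2)" for x y :: real
    using sum_squares_bound[of x y] by (simp add: power2_sum)
  have "(a - b) ^ 4 = ((a - b)\<^sup>2)\<^sup>2" by simp
  also have "\<dots> \<le> (2 * (a\<^sup>2 + b\<^sup>2))\<^sup>2"
    using sq[of a "- b"] by (intro power_mono) simp_all
  also have "\<dots> = 4 * (a\<^sup>2 + b\<^sup>2)\<^sup>2" by (subst power_mult_distrib) simp
  also have "\<dots> \<le> 4 * (2 * ((a\<^sup>2)\<^sup>2 + (b\<^sup>2)\<^sup>2))" by (intro mult_left_mono sq) simp
  finally show ?thesis by simp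
qed

context prob_space
begin

lemma integrable_power2_if_power4:
  fixes f :: "'a \<Rightarrow> real"
  assumes "f \<in> borel_measurable M" "integrable M (\<lambda>x. f x ^ 4)"
  shows "integrable M (\<lambda>x. (f x)\<^sup>2)"
proof (rule Bochner_Integration.integrable_bound[of M "\<lambda>x. 1 + f x ^ 4"])
  show "AE x in M. norm ((f x)\<^sup>2) \<le> norm (1 + f x ^ 4)"
    using power2_le_1_plus_power4 by (auto intro: order_trans[OF _ abs_ge_self])
qed (use assms in auto)

lemma integrable_if_power2:
  fixes f :: "'a \<Rightarrow> real"
  assumes "f \<in> borel_measurable M" "integrable M (\<lambda>x. (f x)\<^sup>2)"
  shows "integrable M f"
proof (rule Bochner_Integration.integrable_bound[of M "\<lambda>x. 1 + (f x)\<^sup>2"])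
  have "\<bar>y\<bar> \<le> 1 + y\<^sup>2" for y :: real
    using sum_squares_bound[of "\<bar>y\<bar>" 1] by simp
  then show "AE x in M. norm (f x) \<le> norm (1 + (f x)\<^sup>2)"
    by (auto intro: order_trans[OF _ abs_ge_self])
qed (use assms in auto)

lemma integrable_mult_if_power2:
  fixes f g :: "'a \<Rightarrow> real"
  assumes "f \<in> borel_measurable M" "integrable M (\<lambda>x. (f x)\<^sup>2)"
    and "g \<in> borel_measurable M" "integrable M (\<lambda>x. (g x)\<^sup>2)"
  shows "integrable M (\<lambda>x. f x * g x)"
proof (rule Bochner_Integration.integrable_bound[of M "\<lambda>x. (f x)\<^sup>2 + (g x)\<^sup>2"])
  have "\<bar>y * z\<bar> \<le> y\<^sup>2 + z\<^sup>2" for y z :: real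
  proof -
    have "2 * \<bar>y * z\<bar> \<le> y\<^sup>2 + z\<^sup>2"
      using sum_squares_bound[of "\<bar>y\<bar>" "\<bar>z\<bar>"] by (simp add: abs_mult)
    then show ?thesis using abs_ge_zero[of "y * z"] by linarith
  qed
  then show "AE x in M. norm (f x * g x) \<le> norm ((f x)\<^sup>2 + (g x)\<^sup>2)"
    by (auto intro: order_trans[OF _ abs_ge_self])
qed (use assms in auto)

text \<open>The elementary core of the fact that a continuous martingale of bounded variation is constant.
  Orthogonality of increments turns \<open>E (D\<^sub>T - D\<^sub>0)\<^sup>2\<close> into the expected sum of squared increments
  along any partition. These sums tend to \<open>0\<close> on Lipschitz paths, and the fourth moments keep them
  bounded in \<open>L\<^sup>2\<close>, hence uniformly integrable.\<close>

lemma orthogonal_increments_lipschitz_constant: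
  fixes D :: "real \<Rightarrow> 'a \<Rightarrow> real"
  assumes meas: "\<And>t. 0 \<le> t \<Longrightarrow> D t \<in> borel_measurable M"
    and fourth_int: "\<And>s t. 0 \<le> s \<Longrightarrow> s \<le> t \<Longrightarrow> integrable M (\<lambda>\<omega>. (D t \<omega> - D s \<omega>) ^ 4)"
    and fourth: "\<And>s t. 0 \<le> s \<Longrightarrow> s \<le> t \<Longrightarrow> expectation (\<lambda>\<omega>. (D t \<omega> - D s \<omega>) ^ 4) \<le> C * (t - s)\<^sup>2"
    and orth: "\<And>u v s t. 0 \<le> u \<Longrightarrow> u \<le> v \<Longrightarrow> v \<le> s \<Longrightarrow> s \<le> t \<Longrightarrow>
      expectation (\<lambda>\<omega>. (D t \<omega> - D s \<omega>) * (D v \<omega> - D u \<omega>)) = 0"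
    and T: "0 \<le> T"
    and lip: "AE \<omega> in M. \<exists>K. \<forall>s\<in>{0..T}. \<forall>t\<in>{0..T}. \<bar>D t \<omega> - D s \<omega>\<bar> \<le> K * \<bar>t - s\<bar>"
  shows "AE \<omega> in M. D T \<omega> = D 0 \<omega>"
proof -
  define p where "p n i = T * real i / real n" for n i :: nat
  define a where "a n i \<omega> = D (p n (Suc i)) \<omega> - D (p n i) \<omega>" for n i \<omega>
  define Q where "Q n \<omega> = (\<Sum>i<n. (a n i \<omega>)\<^sup>2)" for n \<omega>
  define q where "q = expectation (\<lambda>\<omega>. (D T \<omega> - D 0 \<omega>)\<^sup>2)"
  have p_nn: "0 \<le> p n i" for n i using T by (simp add: p_def)
  have p_mono: "p n i \<le> p n j" if "i \<le> j" for n i j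
    unfolding p_def using that T by (intro divide_right_mono mult_left_mono) auto
  have p_step: "p n (Suc i) - p n i = T / real n" for n i
    by (simp add: p_def diff_divide_distrib[symmetric] field_simps)
  have p_le: "p n i \<le> T" if "i \<le> n" "0 < n" for n i
    using p_mono[OF that(1), of n] that by (simp add: p_def)
  note meas_p[measurable] = meas[OF p_nn]
  have meas_a[measurable]: "a n i \<in> borel_measurable M" for n i
    unfolding a_def by measurable
  have meas_Q[measurable]: "Q n \<in> borel_measurable M" for n
    unfolding Q_def by measurable
  have int4: "integrable M (\<lambda>\<omega>. a n i \<omega> ^ 4)" for n i
    unfolding a_def by (intro fourth_int p_nn p_mono) simp
  have int2: "integrable M (\<lambda>\<omega>. (a n i \<omega>)\<^sup>2)" for n i
    by (intro integrable_power2_if_power4 int4 meas_a)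
  have int11: "integrable M (\<lambda>\<omega>. a n i \<omega> * a n j \<omega>)" for n i j
    by (intro integrable_mult_if_power2 int2 meas_a)
  have intQ: "integrable M (Q n)" for n
    unfolding Q_def by (intro Bochner_Integration.integrable_sum int2)
  have orth_a: "expectation (\<lambda>\<omega>. a n i \<omega> * a n j \<omega>) = (if i = j then expectation (\<lambda>\<omega>. (a n i \<omega>)\<^sup>2) else 0)"
    for n i j
  proof (cases i j rule: linorder_cases)
    case less
    then have "expectation (\<lambda>\<omega>. a n j \<omega> * a n i \<omega>) = 0"
      unfolding a_def by (intro orth p_nn p_mono) auto
    then show ?thesis using less by (simp add: mult.commute)
  next
    case greater
    then have "expectation (\<lambda>\<omega>. a n i \<omega> * a n j \<omega>) = 0"
      unfolding a_def by (intro orth p_nn p_mono) auto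
    then show ?thesis using greater by simp
  qed (simp add: power2_eq_square)
  have EQ: "expectation (Q n) = q" if "0 < n" for n
  proof -
    have tele: "D T \<omega> - D 0 \<omega> = (\<Sum>i<n. a n i \<omega>)" for \<omega>
      using that sum_lessThan_telescope[of "\<lambda>i. D (p n i) \<omega>" n] by (simp add: a_def p_def)
    have "q = expectation (\<lambda>\<omega>. \<Sum>i<n. \<Sum>j<n. a n i \<omega> * a n j \<omega>)"
      unfolding q_def tele power2_eq_square sum_product ..
    also have "\<dots> = (\<Sum>i<n. \<Sum>j<n. expectation (\<lambda>\<omega>. a n i \<omega> * a n j \<omega>))"
      by (simp add: Bochner_Integration.integral_sum Bochner_Integration.integrable_sum int11)
    also have "\<dots> = (\<Sum>i<n. expectation (\<lambda>\<omega>. (a n i \<omega>)\<^sup>2))"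
      by (simp add: orth_a)
    also have "\<dots> = expectation (Q n)"
      unfolding Q_def by (simp add: Bochner_Integration.integral_sum int2)
    finally show ?thesis by simp
  qed
  have Qsq_le: "(Q n \<omega>)\<^sup>2 \<le> (\<Sum>i<n. a n i \<omega> ^ 4) * real n" for n \<omega>
    using sum_squared_le_sum_of_squares[of "\<lambda>i. (a n i \<omega>)\<^sup>2" "{..<n}"] by (simp add: Q_def)
  have int_sum4: "integrable M (\<lambda>\<omega>. (\<Sum>i<n. a n i \<omega> ^ 4) * real n)" for n
    by (intro integrable_mult_left Bochner_Integration.integrable_sum int4)
  have intQsq: "integrable M (\<lambda>\<omega>. (Q n \<omega>)\<^sup>2)" for n
    by (rule Bochner_Integration.integrable_bound[OF int_sum4[of n]])
      (use Qsq_le in \<open>auto intro: order_trans[OF _ abs_ge_self]\<close>)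
  have EQsq: "expectation (\<lambda>\<omega>. (Q n \<omega>)\<^sup>2) \<le> C * T\<^sup>2" if "0 < n" for n
  proof -
    have "expectation (\<lambda>\<omega>. (Q n \<omega>)\<^sup>2) \<le> expectation (\<lambda>\<omega>. (\<Sum>i<n. a n i \<omega> ^ 4) * real n)"
      by (intro integral_mono intQsq int_sum4 Qsq_le)
    also have "\<dots> = (\<Sum>i<n. expectation (\<lambda>\<omega>. a n i \<omega> ^ 4)) * real n"
      by (simp add: Bochner_Integration.integral_sum int4)
    also have "\<dots> \<le> (\<Sum>i<n. C * (T / real n)\<^sup>2) * real n"
    proof (intro mult_right_mono sum_mono)
      fix i
      show "expectation (\<lambda>\<omega>. a n i \<omega> ^ 4) \<le> C * (T / real n)\<^sup>2"
        using fourth[of "p n i" "p n (Suc i)"] p_nn p_mono[of i "Suc i" n] p_step[of n i]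
        by (simp add: a_def)
    qed simp
    also have "\<dots> = C * T\<^sup>2" using that by (simp add: power2_eq_square)
    finally show ?thesis .
  qed
  have Q0: "AE \<omega> in M. (\<lambda>n. Q n \<omega>) \<longlonglongrightarrow> 0"
    using lip
  proof eventually_elim
    case (elim \<omega>)
    then obtain K where K: "\<And>s t. s \<in> {0..T} \<Longrightarrow> t \<in> {0..T} \<Longrightarrow> \<bar>D t \<omega> - D s \<omega>\<bar> \<le> K * \<bar>t - s\<bar>"
      by blast
    have bound: "Q n \<omega> \<le> (K * T)\<^sup>2 * (1 / real n)" if "0 < n" for n
    proof -
      have "(a n i \<omega>)\<^sup>2 \<le> (K * (T / real n))\<^sup>2" if "i < n" for i
      proof -
        have "\<bar>a n i \<omega>\<bar> \<le> K * \<bar>p n (Suc i) - p n i\<bar>"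
          unfolding a_def using that by (intro K) (auto intro: p_nn p_le)
        then have "\<bar>a n i \<omega>\<bar> \<le> K * (T / real n)"
          using T by (simp add: p_step)
        then show ?thesis by (metis abs_ge_zero power2_abs power_mono)
      qed
      then have "Q n \<omega> \<le> (\<Sum>i<n. (K * (T / real n))\<^sup>2)"
        unfolding Q_def by (intro sum_mono) auto
      also have "\<dots> = (K * T)\<^sup>2 * (1 / real n)" using \<open>0 < n\<close> by (simp add: power2_eq_square)
      finally show ?thesis .
    qed
    have "(\<lambda>n. (K * T)\<^sup>2 * (1 / real n)) \<longlonglongrightarrow> (K * T)\<^sup>2 * 0"
      by (intro tendsto_intros lim_1_over_n)
    then have lim0: "(\<lambda>n. (K * T)\<^sup>2 * (1 / real n)) \<longlonglongrightarrow> 0" by simp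
    show ?case
    proof (rule tendsto_sandwich[OF _ _ tendsto_const lim0])
      show "\<forall>\<^sub>F n in sequentially. Q n \<omega> \<le> (K * T)\<^sup>2 * (1 / real n)"
        using eventually_gt_at_top[of 0] by eventually_elim (rule bound)
    qed (auto simp: Q_def intro!: always_eventually sum_nonneg)
  qed
  \<comment> \<open>Truncate the sums at level \<open>L\<close>: dominated convergence handles \<open>min (Q n) L\<close>, and the excess is
    at most \<open>(Q n)\<^sup>2 / L\<close>.\<close>
  have q_le: "q \<le> C * T\<^sup>2 * (1 / real L)" if L: "0 < L" for L :: nat
  proof -
    have lim: "(\<lambda>n. expectation (\<lambda>\<omega>. min (Q n \<omega>) (real L))) \<longlonglongrightarrow> expectation (\<lambda>\<omega>. 0)"
    proof (rule integral_dominated_convergence[where w = "\<lambda>_. real L"])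
      show "AE \<omega> in M. (\<lambda>n. min (Q n \<omega>) (real L)) \<longlonglongrightarrow> 0"
        using Q0
      proof eventually_elim
        case (elim \<omega>)
        then have "(\<lambda>n. min (Q n \<omega>) (real L)) \<longlonglongrightarrow> min 0 (real L)" by (intro tendsto_intros)
        then show ?case by simp
      qed
      show "AE \<omega> in M. norm (min (Q n \<omega>) (real L)) \<le> real L" for n
        by (auto simp: Q_def min_def sum_nonneg)
    qed auto
    have "q \<le> expectation (\<lambda>\<omega>. min (Q n \<omega>) (real L)) + C * T\<^sup>2 * (1 / real L)" if n: "0 < n" for n
    proof -
      have int_min: "integrable M (\<lambda>\<omega>. min (Q n \<omega>) (real L))"
        by (rule Bochner_Integration.integrable_bound[OF intQ[of n]])
          (auto simp: Q_def min_def sum_nonneg)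
      have le: "Q n \<omega> \<le> min (Q n \<omega>) (real L) + (Q n \<omega>)\<^sup>2 * (1 / real L)" for \<omega>
      proof (cases "Q n \<omega> \<le> real L")
        case False
        then have "Q n \<omega> * real L \<le> (Q n \<omega>)\<^sup>2" using L by (simp add: power2_eq_square)
        then have "Q n \<omega> \<le> (Q n \<omega>)\<^sup>2 * (1 / real L)" using L by (simp add: field_simps)
        then show ?thesis using False by (simp add: min_def)
      qed simp
      have "q = expectation (Q n)" using EQ[OF n] by simp
      also have "\<dots> \<le> expectation (\<lambda>\<omega>. min (Q n \<omega>) (real L) + (Q n \<omega>)\<^sup>2 * (1 / real L))"
        by (intro integral_mono intQ le Bochner_Integration.integrable_add int_min integrable_mult_left intQsq)
      also have "\<dots> = expectation (\<lambda>\<omega>. min (Q n \<omega>) (real L)) + expectation (\<lambda>\<omega>. (Q n \<omega>)\<^sup>2) * (1 / real L)"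
        using int_min intQsq by simp
      also have "\<dots> \<le> expectation (\<lambda>\<omega>. min (Q n \<omega>) (real L)) + C * T\<^sup>2 * (1 / real L)"
        using EQsq[OF n] by (intro add_left_mono mult_right_mono) auto
      finally show ?thesis .
    qed
    then have ev: "\<forall>\<^sub>F n in sequentially. q \<le> expectation (\<lambda>\<omega>. min (Q n \<omega>) (real L)) + C * T\<^sup>2 * (1 / real L)"
      by (intro eventually_sequentiallyI[of 1]) auto
    have "(\<lambda>n. expectation (\<lambda>\<omega>. min (Q n \<omega>) (real L)) + C * T\<^sup>2 * (1 / real L))
        \<longlonglongrightarrow> 0 + C * T\<^sup>2 * (1 / real L)"
      using lim by (intro tendsto_intros) simp
    from tendsto_lowerbound[OF this ev trivial_limit_sequentially] show ?thesis by simp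
  qed
  have lim: "(\<lambda>L. C * T\<^sup>2 * (1 / real L)) \<longlonglongrightarrow> C * T\<^sup>2 * 0"
    by (intro tendsto_intros lim_1_over_n)
  have "\<forall>\<^sub>F L in sequentially. q \<le> C * T\<^sup>2 * (1 / real L)"
    using eventually_gt_at_top[of 0] by eventually_elim (rule q_le)
  from tendsto_lowerbound[OF lim this trivial_limit_sequentially] have "q \<le> C * T\<^sup>2 * 0" .
  moreover have "0 \<le> q" unfolding q_def by (intro Bochner_Integration.integral_nonneg) simp
  ultimately have "q = 0" by simp
  moreover have "integrable M (\<lambda>\<omega>. (D T \<omega> - D 0 \<omega>)\<^sup>2)"
    using T by (intro integrable_power2_if_power4 fourth_int borel_measurable_diff meas) auto
  ultimately have "AE \<omega> in M. (D T \<omega> - D 0 \<omega>)\<^sup>2 = 0"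
    unfolding q_def by (subst (asm) integral_nonneg_eq_0_iff_AE) auto
  then show ?thesis by eventually_elim simp
qed

end

section \<open>Moments of Brownian increments\<close>

context standard_brownian_motion
begin

lemma measurable_F_imp_measurable_M: "0 \<le> t \<Longrightarrow> f \<in> borel_measurable (F t) \<Longrightarrow> f \<in> borel_measurable M"
  using measurable_from_subalg[OF subalgebra_F] .

lemma measurable_F_mono:
  assumes "0 \<le> s" "s \<le> t" "f \<in> borel_measurable (F s)"
  shows "f \<in> borel_measurable (F t)"
proof (rule measurable_from_subalg[OF _ assms(3)])
  show "subalgebra (F t) (F s)"
    using subalgebra_F[of s] subalgebra_F[of t] F_mono[OF assms(1,2)] assms(1,2)
    by (simp add: subalgebra_def)
qed

lemma measurable_W: "0 \<le> t \<Longrightarrow> W t \<in> borel_measurable M"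
  using adapted measurable_F_imp_measurable_M by blast

lemma increment_component_moments:
  assumes st: "0 \<le> s" "s < t"
  shows "integrable M (\<lambda>\<omega>. ((W t \<omega> - W s \<omega>) $ i) ^ k)"
    and "expectation (\<lambda>\<omega>. (W t \<omega> - W s \<omega>) $ i) = 0"
    and "expectation (\<lambda>\<omega>. ((W t \<omega> - W s \<omega>) $ i)\<^sup>2) = t - s"
    and "expectation (\<lambda>\<omega>. ((W t \<omega> - W s \<omega>) $ i) ^ 4) = 3 * (t - s)\<^sup>2"
proof -
  have \<sigma>: "0 < sqrt (t - s)" using st by simp
  note d = increment_normal[OF st, of i]
  show "integrable M (\<lambda>\<omega>. ((W t \<omega> - W s \<omega>) $ i) ^ k)"
    using distributed_integrable[OF d, of "\<lambda>x. x ^ k"] integrable_normal_moment[OF \<sigma>, of 0 k]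
    by simp
  show "expectation (\<lambda>\<omega>. (W t \<omega> - W s \<omega>) $ i) = 0"
    by (rule normal_distributed_expectation[OF \<sigma> d])
  have even_moment: "expectation (\<lambda>\<omega>. ((W t \<omega> - W s \<omega>) $ i) ^ (2 * n)) =
      fact (2 * n) / ((2 / (sqrt (t - s))\<^sup>2) ^ n * fact n)" for n
    using distributed_integral[OF d, of "\<lambda>x. x ^ (2 * n)"] integral_normal_moment_even[OF \<sigma>, of 0 n]
    by simp
  show "expectation (\<lambda>\<omega>. ((W t \<omega> - W s \<omega>) $ i)\<^sup>2) = t - s"
    using even_moment[of 1] st by (simp add: fact_numeral)
  show "expectation (\<lambda>\<omega>. ((W t \<omega> - W s \<omega>) $ i) ^ 4) = 3 * (t - s)\<^sup>2"
    using even_moment[of 2] st by (simp add: fact_numeral power_divide)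
qed

lemma increment_inner_fourth_moment:
  assumes st: "0 \<le> s" "s \<le> t"
  shows "integrable M (\<lambda>\<omega>. (c \<bullet> (W t \<omega> - W s \<omega>)) ^ 4)"
    and "expectation (\<lambda>\<omega>. (c \<bullet> (W t \<omega> - W s \<omega>)) ^ 4) \<le> 3 * (c \<bullet> c)\<^sup>2 * (real CARD('m))\<^sup>2 * (t - s)\<^sup>2"
proof -
  let ?Z = "\<lambda>\<omega>. W t \<omega> - W s \<omega>"
  have "integrable M (\<lambda>\<omega>. (c \<bullet> ?Z \<omega>) ^ 4) \<and>
    expectation (\<lambda>\<omega>. (c \<bullet> ?Z \<omega>) ^ 4) \<le> 3 * (c \<bullet> c)\<^sup>2 * (real CARD('m))\<^sup>2 * (t - s)\<^sup>2"
  proof (cases "s = t")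
    case False
    then have st': "0 \<le> s" "s < t" using st by auto
    have [measurable]: "W t \<in> borel_measurable M" "W s \<in> borel_measurable M"
      using st by (auto intro: measurable_W)
    have le: "(c \<bullet> z) ^ 4 \<le> (c \<bullet> c)\<^sup>2 * ((\<Sum>i\<in>UNIV. (z $ i) ^ 4) * real CARD('m))" for z :: "real ^ 'm"
    proof -
      have "(c \<bullet> z) ^ 4 = ((c \<bullet> z)\<^sup>2)\<^sup>2" by simp
      also have "\<dots> \<le> ((c \<bullet> c) * (z \<bullet> z))\<^sup>2" by (intro power_mono Cauchy_Schwarz_ineq) simp
      also have "\<dots> = (c \<bullet> c)\<^sup>2 * (\<Sum>i\<in>UNIV. (z $ i)\<^sup>2)\<^sup>2"
        by (simp add: power_mult_distrib inner_vec_def power2_eq_square)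
      also have "\<dots> \<le> (c \<bullet> c)\<^sup>2 * ((\<Sum>i\<in>UNIV. ((z $ i)\<^sup>2)\<^sup>2) * real CARD('m))"
        by (intro mult_left_mono sum_squared_le_sum_of_squares) simp
      finally show ?thesis by simp
    qed
    have int: "integrable M (\<lambda>\<omega>. (c \<bullet> c)\<^sup>2 * ((\<Sum>i\<in>UNIV. (?Z \<omega> $ i) ^ 4) * real CARD('m)))"
      by (intro integrable_mult_left integrable_mult_right Bochner_Integration.integrable_sum
          increment_component_moments st')
    have int': "integrable M (\<lambda>\<omega>. (c \<bullet> ?Z \<omega>) ^ 4)"
      by (rule Bochner_Integration.integrable_bound[OF int])
        (use le in \<open>auto intro: order_trans[OF _ abs_ge_self] simp del: vector_minus_component\<close>)
    have "expectation (\<lambda>\<omega>. (c \<bullet> ?Z \<omega>) ^ 4)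
        \<le> expectation (\<lambda>\<omega>. (c \<bullet> c)\<^sup>2 * ((\<Sum>i\<in>UNIV. (?Z \<omega> $ i) ^ 4) * real CARD('m)))"
      by (intro integral_mono int int' le)
    also have "\<dots> = (c \<bullet> c)\<^sup>2 * ((\<Sum>i\<in>(UNIV :: 'm set). 3 * (t - s)\<^sup>2) * real CARD('m))"
      by (simp add: Bochner_Integration.integral_sum increment_component_moments[OF st']
          del: vector_minus_component)
    also have "\<dots> = 3 * (c \<bullet> c)\<^sup>2 * (real CARD('m))\<^sup>2 * (t - s)\<^sup>2"
      by (simp add: power2_eq_square)
    finally show ?thesis using int' by simp
  qed simp
  then show "integrable M (\<lambda>\<omega>. (c \<bullet> ?Z \<omega>) ^ 4)"
    "expectation (\<lambda>\<omega>. (c \<bullet> ?Z \<omega>) ^ 4) \<le> 3 * (c \<bullet> c)\<^sup>2 * (real CARD('m))\<^sup>2 * (t - s)\<^sup>2"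
    by auto
qed

lemma increment_inner_covariance:
  assumes st: "0 \<le> s" "s < t"
  shows "expectation (\<lambda>\<omega>. (c \<bullet> (W t \<omega> - W s \<omega>)) * (e \<bullet> (W t \<omega> - W s \<omega>))) = (t - s) * (c \<bullet> e)"
proof -
  let ?Z = "\<lambda>i \<omega>. (W t \<omega> - W s \<omega>) $ i"
  note mom = increment_component_moments[OF st]
  have int1: "integrable M (?Z i)" for i using mom(1)[of i 1] by simp
  have cov: "integrable M (\<lambda>\<omega>. ?Z i \<omega> * ?Z j \<omega>) \<and>
      expectation (\<lambda>\<omega>. ?Z i \<omega> * ?Z j \<omega>) = (if i = j then t - s else 0)" for i j
  proof (cases "i = j")
    case True
    then show ?thesis
      using mom(1)[of i 2] mom(3)[of i] by (simp add: power2_eq_square)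
  next
    case False
    have "indep_vars (\<lambda>_. borel) ?Z {i, j}"
      using increment_components_indep[OF st] by (rule indep_vars_subset) simp
    from indep_vars_integrable[OF _ this int1] indep_vars_lebesgue_integral[OF _ this int1] False
    show ?thesis by (simp add: mom(2) del: vector_minus_component)
  qed
  have "expectation (\<lambda>\<omega>. (c \<bullet> (W t \<omega> - W s \<omega>)) * (e \<bullet> (W t \<omega> - W s \<omega>)))
      = expectation (\<lambda>\<omega>. \<Sum>i\<in>UNIV. \<Sum>j\<in>UNIV. (c $ i * e $ j) * (?Z i \<omega> * ?Z j \<omega>))"
    unfolding inner_vec_def inner_real_def sum_product by (simp only: ac_simps)
  also have "\<dots> = (\<Sum>i\<in>UNIV. \<Sum>j\<in>UNIV. (c $ i * e $ j) * (if i = j then t - s else 0))"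
    using cov by (simp add: Bochner_Integration.integral_sum Bochner_Integration.integrable_sum
        del: vector_minus_component)
  also have "\<dots> = (t - s) * (c \<bullet> e)"
    by (simp add: inner_vec_def if_distrib sum_distrib_left ac_simps cong: if_cong)
  finally show ?thesis .
qed

text \<open>The martingale property of Brownian motion, tested against integrable variables known at
  time \<open>s\<close>.\<close>

lemma increment_inner_orthogonal_past:
  assumes st: "0 \<le> s" "s \<le> t" and U: "U \<in> borel_measurable (F s)" "integrable M U"
  shows "expectation (\<lambda>\<omega>. (c \<bullet> (W t \<omega> - W s \<omega>)) * U \<omega>) = 0"
proof (cases "s = t")
  case False
  then have st': "0 \<le> s" "s < t" using st by auto
  let ?Z = "\<lambda>i \<omega>. (W t \<omega> - W s \<omega>) $ i"
  note mom = increment_component_moments[OF st']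
  have [measurable]: "W t \<in> borel_measurable M" "W s \<in> borel_measurable M"
    using st by (auto intro: measurable_W)
  have "integrable M (\<lambda>\<omega>. ?Z i \<omega> * U \<omega>) \<and> expectation (\<lambda>\<omega>. ?Z i \<omega> * U \<omega>) = 0" for i
  proof -
    have Z_meas: "?Z i \<in> borel_measurable M"
      using distributed_measurable[OF increment_normal[OF st', of i]] by simp
    have "indep_set {U -` B \<inter> space M | B. B \<in> sets borel}
        {?Z i -` B \<inter> space M | B. B \<in> sets borel}"
      unfolding indep_sets2_eq
    proof (intro conjI subsetI ballI)
      have UF: "U -` B \<inter> space M \<in> sets (F s)" if "B \<in> sets borel" for B
        using measurable_sets[OF U(1) that] subalgebra_F[OF st(1)] by (simp add: subalgebra_def)
      have ZW: "\<exists>B'\<in>sets borel. ?Z i -` B \<inter> space M = (\<lambda>\<omega>. W t \<omega> - W s \<omega>) -` B' \<inter> space M"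
        if "B \<in> sets borel" for B
      proof
        have "(\<lambda>x :: real ^ 'm. x $ i) \<in> borel_measurable borel" by measurable
        from measurable_sets[OF this that] show "(\<lambda>x. x $ i) -` B \<in> sets borel" by simp
      qed auto
      fix a b
      { assume "a \<in> {U -` B \<inter> space M | B. B \<in> sets borel}"
        then show "a \<in> events"
          using UF subalgebra_F[OF st(1)] by (auto simp: subalgebra_def) }
      { assume "b \<in> {?Z i -` B \<inter> space M | B. B \<in> sets borel}"
        then show "b \<in> events"
          using measurable_sets[OF Z_meas] by auto }
      assume a: "a \<in> {U -` B \<inter> space M | B. B \<in> sets borel}"
        and b: "b \<in> {?Z i -` B \<inter> space M | B. B \<in> sets borel}"
      obtain B where "B \<in> sets borel" "b = ?Z i -` B \<inter> space M" using b by blast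
      then obtain B' where "B' \<in> sets borel" "b = (\<lambda>\<omega>. W t \<omega> - W s \<omega>) -` B' \<inter> space M"
        using ZW by metis
      then have "b \<in> {(\<lambda>\<omega>. W t \<omega> - W s \<omega>) -` B \<inter> space M | B. B \<in> sets borel}" by blast
      moreover have "a \<in> sets (F s)" using a UF by blast
      ultimately show "prob (a \<inter> b) = prob a * prob b"
        by (intro indep_setD[OF increment_indep[OF st']])
    qed
    moreover have "Int_stable {f -` B \<inter> space M | B. B \<in> sets borel}" for f :: "'w \<Rightarrow> real"
    proof (rule Int_stableI, clarify)
      fix B B' :: "real set" assume "B \<in> sets borel" "B' \<in> sets borel"
      then show "\<exists>C. (f -` B \<inter> space M) \<inter> (f -` B' \<inter> space M) = f -` C \<inter> space M \<and> C \<in> sets borel"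
        by (intro exI[of _ "B \<inter> B'"]) auto
    qed
    ultimately have "indep_set (sigma_sets (space M) {U -` B \<inter> space M | B. B \<in> sets borel})
        (sigma_sets (space M) {?Z i -` B \<inter> space M | B. B \<in> sets borel})"
      by (intro indep_set_sigma_sets)
    then have ind: "indep_var borel U borel (?Z i)"
      unfolding indep_var_eq using borel_measurable_integrable[OF U(2)] Z_meas by blast
    have int1: "integrable M (?Z i)" using mom(1)[of i 1] by simp
    from indep_var_integrable[OF ind U(2) int1] indep_var_lebesgue_integral[OF ind U(2) int1]
    show ?thesis by (simp only: mom(2) mult.commute) simp
  qed
  then have "expectation (\<lambda>\<omega>. \<Sum>i\<in>UNIV. c $ i * (?Z i \<omega> * U \<omega>)) = 0"
    by (simp add: Bochner_Integration.integral_sum del: vector_minus_component)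
  then show ?thesis
    by (simp add: inner_vec_def sum_distrib_right mult.assoc)
qed simp

end

section \<open>Strong solutions and necessity of the rank condition\<close>

lemma borel_measurable_integral_continuous:
  fixes Y :: "real \<Rightarrow> 'w \<Rightarrow> 'a::euclidean_space"
  assumes meas: "\<And>s. s \<in> {0..t} \<Longrightarrow> Y s \<in> borel_measurable N" and t: "0 \<le> t"
    and cont: "\<And>\<omega>. \<omega> \<in> space N \<Longrightarrow> continuous_on {0..t} (\<lambda>s. Y s \<omega>)"
  shows "(\<lambda>\<omega>. integral {0..t} (\<lambda>s. Y s \<omega>)) \<in> borel_measurable N"
proof (rule borel_measurable_LIMSEQ_metric)
  fix n
  show "(\<lambda>\<omega>. \<Sum>k<n. (t / real n) *\<^sub>R Y (t * real k / real n) \<omega>) \<in> borel_measurable N"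
  proof (intro borel_measurable_sum borel_measurable_scaleR borel_measurable_const meas)
    fix k assume "k \<in> {..<n}"
    then show "t * real k / real n \<in> {0..t}"
      using t by (auto simp: field_simps intro!: mult_left_mono)
  qed
next
  fix \<omega> assume "\<omega> \<in> space N"
  then show "(\<lambda>n. \<Sum>k<n. (t / real n) *\<^sub>R Y (t * real k / real n) \<omega>)
      \<longlonglongrightarrow> integral {0..t} (\<lambda>s. Y s \<omega>)"
    using riemann_sum_tendsto_integral[OF cont t] by blast
qed

lemma borel_measurable_matrix_vector [measurable (raw)]:
  fixes A :: "real ^ 'n ^ 'm"
  assumes "f \<in> borel_measurable N"
  shows "(\<lambda>\<omega>. A *v f \<omega>) \<in> borel_measurable N"
  using measurable_compose[OF assms, of "(*v) A" borel]
  by (simp add: borel_measurable_continuous_onI linear_continuous_on)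

context standard_brownian_motion
begin

text \<open>The noise enters additively, so the equation is solved for each path separately, by Picard
  iteration. Every iterate at time \<open>t\<close> is an integral over \<open>{0..t}\<close>, hence a limit of Riemann sums
  that only involve times up to \<open>t\<close>; this gives adaptedness.\<close>

lemma strong_solution_exists:
  fixes x0 :: "real ^ 'd" and A :: "real ^ 'd ^ 'd" and G :: "real ^ 'm ^ 'd"
  shows "\<exists>X. strong_solution M F W x0 A G X"
proof -
  define b where "b \<omega> t = x0 + G *v (W t \<omega> - W 0 \<omega>)" for \<omega> t
  have contb: "continuous_on {0..} (b \<omega>)" if "\<omega> \<in> space M" for \<omega>
    unfolding b_def
    by (intro continuous_intros bounded_linear.continuous_on[OF matrix_vector_mul_bounded_linear]
        continuous_paths that)
  define X where "X t \<omega> = lim (\<lambda>n. picard A (b \<omega>) n t)" for t \<omega>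
  have X: "continuous_on {0..} (\<lambda>t. X t \<omega>) \<and>
      (\<forall>t\<ge>0. (\<lambda>n. picard A (b \<omega>) n t) \<longlonglongrightarrow> X t \<omega> \<and>
        X t \<omega> = b \<omega> t + integral {0..t} (\<lambda>s. A *v X s \<omega>))"
    if \<omega>: "\<omega> \<in> space M" for \<omega>
  proof -
    obtain x where x: "continuous_on {0..} x"
      "\<And>t. 0 \<le> t \<Longrightarrow> (\<lambda>n. picard A (b \<omega>) n t) \<longlonglongrightarrow> x t"
      "\<And>t. 0 \<le> t \<Longrightarrow> x t = b \<omega> t + integral {0..t} (\<lambda>s. A *v x s)"
      using picard_converges[OF contb[OF \<omega>], of A] by blast
    have eq: "X t \<omega> = x t" if "0 \<le> t" for t
      using x(2)[OF that] by (simp add: X_def limI)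
    have "continuous_on {0..} (\<lambda>t. X t \<omega>) \<longleftrightarrow> continuous_on {0..} x"
      by (rule continuous_on_cong) (auto simp: eq)
    moreover have "integral {0..t} (\<lambda>s. A *v X s \<omega>) = integral {0..t} (\<lambda>s. A *v x s)" for t
      by (rule integral_cong) (simp add: eq)
    ultimately show ?thesis using x eq by simp
  qed
  have meas_b: "(\<lambda>\<omega>. b \<omega> t) \<in> borel_measurable (F t)" if "0 \<le> t" for t
  proof -
    have [measurable]: "W t \<in> borel_measurable (F t)" "W 0 \<in> borel_measurable (F t)"
      using that adapted measurable_F_mono[of 0 t "W 0"] by auto
    show ?thesis by (simp add: b_def)
  qed
  have meas_picard: "(\<lambda>\<omega>. picard A (b \<omega>) n t) \<in> borel_measurable (F t)" if "0 \<le> t" for n t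
    using that
  proof (induction n arbitrary: t)
    case 0
    then show ?case by (simp add: meas_b)
  next
    case (Suc n)
    have sp: "space (F t) = space M"
      using subalgebra_F[OF Suc.prems] by (simp add: subalgebra_def)
    have "(\<lambda>\<omega>. integral {0..t} (\<lambda>s. A *v picard A (b \<omega>) n s)) \<in> borel_measurable (F t)"
    proof (rule borel_measurable_integral_continuous[OF _ Suc.prems])
      fix s assume s: "s \<in> {0..t}"
      then have "(\<lambda>\<omega>. picard A (b \<omega>) n s) \<in> borel_measurable (F t)"
        by (intro measurable_F_mono[of s t] Suc.IH) auto
      then show "(\<lambda>\<omega>. A *v picard A (b \<omega>) n s) \<in> borel_measurable (F t)"
        by measurable
    next
      fix \<omega> assume "\<omega> \<in> space (F t)"
      then have "\<omega> \<in> space M" by (simp add: sp)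
      then show "continuous_on {0..t} (\<lambda>s. A *v picard A (b \<omega>) n s)"
        by (intro bounded_linear.continuous_on[OF matrix_vector_mul_bounded_linear]
            continuous_on_subset[OF continuous_on_picard[OF contb]]) auto
    qed
    then show ?case
      unfolding picard.simps by (intro borel_measurable_add meas_b Suc.prems)
  qed
  have "X t \<in> borel_measurable (F t)" if t: "0 \<le> t" for t
  proof (rule borel_measurable_LIMSEQ_metric[OF meas_picard[OF t]])
    fix \<omega> assume "\<omega> \<in> space (F t)"
    then have "\<omega> \<in> space M" using subalgebra_F[OF t] by (simp add: subalgebra_def)
    then show "(\<lambda>n. picard A (b \<omega>) n t) \<longlonglongrightarrow> X t \<omega>" using X t by blast
  qed
  moreover have "AE \<omega> in M. \<forall>t\<ge>0.
      X t \<omega> = x0 + integral {0..t} (\<lambda>s. A *v X s \<omega>) + G *v (W t \<omega> - W 0 \<omega>)"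
  proof (rule AE_I2, intro allI impI)
    fix \<omega> t assume "\<omega> \<in> space M" "(0::real) \<le> t"
    with X[of \<omega>] have "X t \<omega> = b \<omega> t + integral {0..t} (\<lambda>s. A *v X s \<omega>)" by blast
    then show "X t \<omega> = x0 + integral {0..t} (\<lambda>s. A *v X s \<omega>) + G *v (W t \<omega> - W 0 \<omega>)"
      by (simp add: b_def)
  qed
  ultimately have "strong_solution M F W x0 A G X"
    unfolding strong_solution_def using X by blast
  then show ?thesis by (rule exI[of _ X])
qed

lemma strong_solution_sde_solution: "strong_solution M F W x0 A G (sde_solution M F W x0 A G)"
  unfolding sde_solution_def by (rule someI_ex[OF strong_solution_exists])

lemma strong_solution_continuous:
  "strong_solution M F W x0 A G X \<Longrightarrow> \<omega> \<in> space M \<Longrightarrow> continuous_on {0..} (\<lambda>t. X t \<omega>)"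
  by (simp add: strong_solution_def)

lemma strong_solution_adapted:
  "strong_solution M F W x0 A G X \<Longrightarrow> 0 \<le> s \<Longrightarrow> s \<le> t \<Longrightarrow> X s \<in> borel_measurable (F t)"
  using measurable_F_mono[of s t "X s"] by (simp add: strong_solution_def)

lemma strong_solution_measurable:
  "strong_solution M F W x0 A G X \<Longrightarrow> 0 \<le> t \<Longrightarrow> X t \<in> borel_measurable M"
  using measurable_F_imp_measurable_M strong_solution_adapted[of x0 A G X t t] by blast

lemma measurable_path:
  assumes "strong_solution M F W x0 A G X"
  shows "(\<lambda>\<omega>. \<lambda>t\<in>{0..}. X t \<omega>) \<in> measurable M (\<Pi>\<^sub>M t\<in>{0..}. borel)"
  by (rule measurable_restrict) (simp add: strong_solution_measurable[OF assms])

text \<open>The integral equation tested against a vector.\<close>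

lemma strong_solution_inner:
  fixes X :: "real \<Rightarrow> 'w \<Rightarrow> real ^ 'd"
  assumes X: "strong_solution M F W x0 A G X"
  shows "AE \<omega> in M. \<forall>t\<ge>0. \<forall>w. w \<bullet> X t \<omega> =
    w \<bullet> x0 + integral {0..t} (\<lambda>s. (w v* A) \<bullet> X s \<omega>) + (w v* G) \<bullet> (W t \<omega> - W 0 \<omega>)"
proof -
  have "AE \<omega> in M. \<forall>t\<ge>0.
      X t \<omega> = x0 + integral {0..t} (\<lambda>s. A *v X s \<omega>) + G *v (W t \<omega> - W 0 \<omega>)"
    using X by (simp add: strong_solution_def)
  then show ?thesis
    using AE_space
  proof eventually_elim
    case (elim \<omega>)
    show ?case
    proof (intro allI impI)
      fix t w assume t: "(0::real) \<le> t"
      have "continuous_on {0..t} (\<lambda>s. A *v X s \<omega>)"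
        by (intro bounded_linear.continuous_on[OF matrix_vector_mul_bounded_linear]
            continuous_on_subset[OF strong_solution_continuous[OF X elim(2)]]) auto
      then have "w \<bullet> integral {0..t} (\<lambda>s. A *v X s \<omega>) = integral {0..t} (\<lambda>s. (w v* A) \<bullet> X s \<omega>)"
        by (simp add: inner_integral dot_lmul_matrix)
      moreover have "w \<bullet> X t \<omega> = w \<bullet> (x0 + integral {0..t} (\<lambda>s. A *v X s \<omega>) + G *v (W t \<omega> - W 0 \<omega>))"
        using elim(1) t by metis
      ultimately show "w \<bullet> X t \<omega> =
          w \<bullet> x0 + integral {0..t} (\<lambda>s. (w v* A) \<bullet> X s \<omega>) + (w v* G) \<bullet> (W t \<omega> - W 0 \<omega>)"
        by (simp add: inner_add_right dot_lmul_matrix)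
    qed
  qed
qed

text \<open>Two strong solutions for the same data are indistinguishable.\<close>

lemma path_law_unique:
  fixes X Y :: "real \<Rightarrow> 'w \<Rightarrow> real ^ 'd"
  assumes X: "strong_solution M F W x0 A G X" and Y: "strong_solution M F W x0 A G Y"
  shows "path_law M X = path_law M Y"
proof -
  have "AE \<omega> in M. (\<lambda>t\<in>{0..}. X t \<omega>) = (\<lambda>t\<in>{0..}. Y t \<omega>)"
    using strong_solution_inner[OF X] strong_solution_inner[OF Y] AE_space
  proof eventually_elim
    case (elim \<omega>)
    note cX = strong_solution_continuous[OF X elim(3)]
    note cY = strong_solution_continuous[OF Y elim(3)]
    have "w \<bullet> (X t \<omega> - Y t \<omega>) = 0" if t: "0 \<le> t" for w t
    proof (rule volterra_orthogonal[where S = UNIV and A = A and X = "\<lambda>t. X t \<omega> - Y t \<omega>"])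
      show "continuous_on {0..} (\<lambda>t. X t \<omega> - Y t \<omega>)"
        by (intro continuous_intros cX cY)
      fix w t assume t: "(0::real) \<le> t"
      have "integral {0..t} (\<lambda>s. (w v* A) \<bullet> X s \<omega> - (w v* A) \<bullet> Y s \<omega>)
          = integral {0..t} (\<lambda>s. (w v* A) \<bullet> X s \<omega>) - integral {0..t} (\<lambda>s. (w v* A) \<bullet> Y s \<omega>)"
        by (intro integral_diff integrable_continuous_real continuous_intros
            continuous_on_subset[OF cX] continuous_on_subset[OF cY]) auto
      moreover have "w \<bullet> X t \<omega> =
          w \<bullet> x0 + integral {0..t} (\<lambda>s. (w v* A) \<bullet> X s \<omega>) + (w v* G) \<bullet> (W t \<omega> - W 0 \<omega>)"
        "w \<bullet> Y t \<omega> =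
          w \<bullet> x0 + integral {0..t} (\<lambda>s. (w v* A) \<bullet> Y s \<omega>) + (w v* G) \<bullet> (W t \<omega> - W 0 \<omega>)"
        using elim t by blast+
      ultimately show "w \<bullet> (X t \<omega> - Y t \<omega>) = integral {0..t} (\<lambda>s. (w v* A) \<bullet> (X s \<omega> - Y s \<omega>))"
        by (simp add: inner_diff_right)
    qed (use t in auto)
    then have "X t \<omega> = Y t \<omega>" if "0 \<le> t" for t
      using that by (metis eq_iff_diff_eq_0 inner_eq_zero_iff)
    then show ?case by (intro restrict_ext) simp
  qed
  then show ?thesis
    unfolding path_law_def by (intro distr_cong_AE measurable_path[OF X] measurable_path[OF Y]) auto
qed

text \<open>A vector orthogonal to the Krylov space is orthogonal to the whole path, so that a rank one
  perturbation of \<open>A\<close> that only sees this direction does not change the solution.\<close>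

lemma rank_deficient_imp_same_law:
  fixes x0 :: "real ^ 'd" and A :: "real ^ 'd ^ 'd" and G :: "real ^ 'm ^ 'd"
  assumes w: "w \<noteq> 0" and orth: "\<And>k. (w v* matpow A k) \<bullet> x0 = 0" "\<And>k. (w v* matpow A k) v* G = 0"
  obtains A' where "A' \<noteq> A"
    "path_law M (sde_solution M F W x0 A G) = path_law M (sde_solution M F W x0 A' G)"
proof -
  define A' where "A' = A + (\<chi> i j. w $ i * w $ j)"
  have A': "A' *v x = A *v x + (w \<bullet> x) *\<^sub>R w" for x
    by (simp add: A'_def vec_eq_iff matrix_vector_mult_def inner_vec_def algebra_simps sum.distrib sum_distrib_left)
  let ?X = "sde_solution M F W x0 A G"
  note X = strong_solution_sde_solution[of x0 A G]
  have "AE \<omega> in M. \<forall>t\<ge>0. w \<bullet> ?X t \<omega> = 0"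
    using strong_solution_inner[OF X] AE_space
  proof eventually_elim
    case (elim \<omega>)
    have "u \<bullet> ?X t \<omega> = 0" if "u \<in> range (\<lambda>k. w v* matpow A k)" "0 \<le> t" for u t
    proof (rule volterra_orthogonal[OF strong_solution_continuous[OF X elim(2)] _ _ that])
      fix u assume u: "u \<in> range (\<lambda>k. w v* matpow A k)"
      then obtain k where k: "u = w v* matpow A k" by blast
      then have "u v* A = w v* matpow A (Suc k)"
        by (simp add: matpow_Suc_right vector_matrix_mul_assoc)
      then show "u v* A \<in> range (\<lambda>k. w v* matpow A k)" by blast
      fix t :: real assume "0 \<le> t"
      then show "u \<bullet> ?X t \<omega> = integral {0..t} (\<lambda>s. (u v* A) \<bullet> ?X s \<omega>)"
        using elim(1) orth[of k] by (simp add: k)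
    qed
    moreover have "w \<in> range (\<lambda>k. w v* matpow A k)"
      by (rule range_eqI[of _ _ 0]) simp
    ultimately show ?case by blast
  qed
  moreover have "AE \<omega> in M. \<forall>t\<ge>0.
      ?X t \<omega> = x0 + integral {0..t} (\<lambda>s. A *v ?X s \<omega>) + G *v (W t \<omega> - W 0 \<omega>)"
    using X by (simp add: strong_solution_def)
  ultimately have "AE \<omega> in M. \<forall>t\<ge>0.
      ?X t \<omega> = x0 + integral {0..t} (\<lambda>s. A' *v ?X s \<omega>) + G *v (W t \<omega> - W 0 \<omega>)"
  proof eventually_elim
    case (elim \<omega>)
    have "integral {0..t} (\<lambda>s. A' *v ?X s \<omega>) = integral {0..t} (\<lambda>s. A *v ?X s \<omega>)" for t
      by (rule integral_cong) (use elim(1) in \<open>simp add: A'\<close>)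
    then show ?case using elim(2) by simp
  qed
  then have "strong_solution M F W x0 A' G ?X"
    using X by (simp add: strong_solution_def)
  then have "path_law M ?X = path_law M (sde_solution M F W x0 A' G)"
    by (rule path_law_unique[OF _ strong_solution_sde_solution])
  moreover have "A' \<noteq> A"
  proof
    assume "A' = A"
    then have "(w \<bullet> w) *\<^sub>R w = 0" using A'[of w] by simp
    then show False using w by simp
  qed
  ultimately show ?thesis using that by blast
qed

end

section \<open>The innovation functional and sufficiency of the rank condition\<close>

text \<open>The functional \<open>w \<bullet> (f t - x0) - \<integral>\<^sub>0\<^sup>t w \<bullet> A f\<close> of a path \<open>f\<close>. Almost surely, on the solution for
  \<open>(A, G)\<close> it equals \<open>w \<bullet> G (W t - W 0)\<close>. The integral is written as a limit of Riemann sums, which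
  makes the functional defined and measurable on the full product space.\<close>

definition innovation :: "real ^ 'd ^ 'd \<Rightarrow> real ^ 'd \<Rightarrow> real ^ 'd \<Rightarrow> real \<Rightarrow> (real \<Rightarrow> real ^ 'd) \<Rightarrow> real" where
  "innovation A x0 w t f = w \<bullet> (f t - x0) -
     lim (\<lambda>n. \<Sum>k<n. (t / real n) *\<^sub>R ((w v* A) \<bullet> f (t * real k / real n)))"

lemma innovation_eq_integral:
  assumes "continuous_on {0..} f" "0 \<le> t"
  shows "innovation A x0 w t f = w \<bullet> (f t - x0) - integral {0..t} (\<lambda>s. (w v* A) \<bullet> f s)"
proof -
  have "continuous_on {0..t} (\<lambda>s. (w v* A) \<bullet> f s)"
    by (intro continuous_intros continuous_on_subset[OF assms(1)]) auto
  from riemann_sum_tendsto_integral[OF this assms(2)] show ?thesis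
    unfolding innovation_def by (subst limI) auto
qed

lemma borel_measurable_innovation:
  fixes Y :: "real \<Rightarrow> 'w \<Rightarrow> real ^ 'd"
  assumes meas: "\<And>s. s \<in> {0..t} \<Longrightarrow> Y s \<in> borel_measurable N" and t: "0 \<le> t"
  shows "(\<lambda>\<omega>. innovation A x0 w t (\<lambda>s. Y s \<omega>)) \<in> borel_measurable N"
proof -
  have "(\<lambda>\<omega>. lim (\<lambda>n. \<Sum>k<n. (t / real n) *\<^sub>R ((w v* A) \<bullet> Y (t * real k / real n) \<omega>)))
      \<in> borel_measurable N"
  proof (intro borel_measurable_lim_metric borel_measurable_sum borel_measurable_scaleR
      borel_measurable_inner borel_measurable_const meas)
    fix n k :: nat assume "k \<in> {..<n}"
    then show "t * real k / real n \<in> {0..t}"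
      using t by (auto simp: field_simps intro!: mult_left_mono)
  qed
  then show ?thesis
    unfolding innovation_def
    by (intro borel_measurable_diff borel_measurable_inner borel_measurable_const meas) (use t in auto)
qed

lemma innovation_restrict:
  assumes "0 \<le> t"
  shows "innovation A x0 w t (restrict f {0..}) = innovation A x0 w t f"
  using assms by (simp add: innovation_def)

lemma measurable_innovation_path:
  assumes "0 \<le> t"
  shows "innovation A x0 w t \<in> borel_measurable (\<Pi>\<^sub>M t\<in>{0..}. borel)"
proof -
  have "(\<lambda>f. innovation A x0 w t (\<lambda>s. f s)) \<in> borel_measurable (\<Pi>\<^sub>M t\<in>{0..}. borel)"
    using assms by (intro borel_measurable_innovation measurable_component_singleton) auto
  then show ?thesis by simp
qed

context standard_brownian_motion
begin

lemma innovation_adapted: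
  assumes X: "strong_solution M F W x0 A G X" and "0 \<le> s" "s \<le> t"
  shows "(\<lambda>\<omega>. innovation A' x0' w s (\<lambda>r. X r \<omega>)) \<in> borel_measurable (F t)"
  using assms by (intro borel_measurable_innovation strong_solution_adapted[OF X]) auto

lemma innovation_measurable:
  assumes X: "strong_solution M F W x0 A G X" and "0 \<le> t"
  shows "(\<lambda>\<omega>. innovation A' x0' w t (\<lambda>r. X r \<omega>)) \<in> borel_measurable M"
  using measurable_F_imp_measurable_M innovation_adapted[OF X] assms(2) by blast

lemma strong_solution_innovation:
  assumes X: "strong_solution M F W x0 A G X"
  shows "AE \<omega> in M. \<forall>t\<ge>0. innovation A x0 w t (\<lambda>r. X r \<omega>) = (w v* G) \<bullet> (W t \<omega> - W 0 \<omega>)"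
  using strong_solution_inner[OF X] AE_space
proof eventually_elim
  case (elim \<omega>)
  then show ?case
    using innovation_eq_integral[OF strong_solution_continuous[OF X elim(2)]]
    by (simp add: inner_diff_right)
qed

lemma strong_solution_innovation_increment:
  assumes X: "strong_solution M F W x0 A G X" and st: "0 \<le> s" "s \<le> t"
  shows "AE \<omega> in M. innovation A x0 w t (\<lambda>r. X r \<omega>) - innovation A x0 w s (\<lambda>r. X r \<omega>)
    = (w v* G) \<bullet> (W t \<omega> - W s \<omega>)"
  using strong_solution_innovation[OF X, of w]
proof eventually_elim
  case (elim \<omega>)
  then show ?case using st by (simp add: inner_diff_right)
qed

lemma innovation_fourth_moment:
  assumes X: "strong_solution M F W x0 A G X"
  obtains C where "\<And>s t. 0 \<le> s \<Longrightarrow> s \<le> t \<Longrightarrow>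
      integrable M (\<lambda>\<omega>. (innovation A x0 w t (\<lambda>r. X r \<omega>) - innovation A x0 w s (\<lambda>r. X r \<omega>)) ^ 4)"
    "\<And>s t. 0 \<le> s \<Longrightarrow> s \<le> t \<Longrightarrow>
      expectation (\<lambda>\<omega>. (innovation A x0 w t (\<lambda>r. X r \<omega>) - innovation A x0 w s (\<lambda>r. X r \<omega>)) ^ 4)
        \<le> C * (t - s)\<^sup>2"
proof -
  let ?c = "w v* G"
  let ?N = "\<lambda>t \<omega>. innovation A x0 w t (\<lambda>r. X r \<omega>)"
  have *: "integrable M (\<lambda>\<omega>. (?N t \<omega> - ?N s \<omega>) ^ 4) \<and>
      expectation (\<lambda>\<omega>. (?N t \<omega> - ?N s \<omega>) ^ 4) \<le> (3 * (?c \<bullet> ?c)\<^sup>2 * (real CARD('m))\<^sup>2) * (t - s)\<^sup>2"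
    if st: "0 \<le> s" "s \<le> t" for s t
  proof -
    have [measurable]: "?N t \<in> borel_measurable M" "?N s \<in> borel_measurable M"
      "W t \<in> borel_measurable M" "W s \<in> borel_measurable M"
      using st by (auto intro: innovation_measurable[OF X] measurable_W)
    have eq: "AE \<omega> in M. (?N t \<omega> - ?N s \<omega>) ^ 4 = (?c \<bullet> (W t \<omega> - W s \<omega>)) ^ 4"
      using strong_solution_innovation_increment[OF X st, of w] by eventually_elim simp
    have "integrable M (\<lambda>\<omega>. (?N t \<omega> - ?N s \<omega>) ^ 4) \<longleftrightarrow> integrable M (\<lambda>\<omega>. (?c \<bullet> (W t \<omega> - W s \<omega>)) ^ 4)"
      by (rule integrable_cong_AE[OF _ _ eq]) measurable
    moreover have "expectation (\<lambda>\<omega>. (?N t \<omega> - ?N s \<omega>) ^ 4) = expectation (\<lambda>\<omega>. (?c \<bullet> (W t \<omega> - W s \<omega>)) ^ 4)"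
      by (rule integral_cong_AE[OF _ _ eq]) measurable
    ultimately show ?thesis using increment_inner_fourth_moment[OF st, of ?c] by simp
  qed
  show ?thesis
    using that[of "3 * (?c \<bullet> ?c)\<^sup>2 * (real CARD('m))\<^sup>2"] * by blast
qed

lemma innovation_orthogonal_past:
  assumes X: "strong_solution M F W x0 A G X" and st: "0 \<le> s" "s \<le> t"
    and U: "U \<in> borel_measurable (F s)" "integrable M U"
  shows "expectation (\<lambda>\<omega>. (innovation A x0 w t (\<lambda>r. X r \<omega>) - innovation A x0 w s (\<lambda>r. X r \<omega>)) * U \<omega>) = 0"
proof -
  have [measurable]: "(\<lambda>\<omega>. innovation A x0 w t (\<lambda>r. X r \<omega>)) \<in> borel_measurable M"
      "(\<lambda>\<omega>. innovation A x0 w s (\<lambda>r. X r \<omega>)) \<in> borel_measurable M"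
      "W t \<in> borel_measurable M" "W s \<in> borel_measurable M" "U \<in> borel_measurable M"
    using st U by (auto intro: innovation_measurable[OF X] measurable_W)
  have "expectation (\<lambda>\<omega>. (innovation A x0 w t (\<lambda>r. X r \<omega>) - innovation A x0 w s (\<lambda>r. X r \<omega>)) * U \<omega>)
      = expectation (\<lambda>\<omega>. ((w v* G) \<bullet> (W t \<omega> - W s \<omega>)) * U \<omega>)"
  proof (rule integral_cong_AE)
    show "AE \<omega> in M. (innovation A x0 w t (\<lambda>r. X r \<omega>) - innovation A x0 w s (\<lambda>r. X r \<omega>)) * U \<omega>
        = ((w v* G) \<bullet> (W t \<omega> - W s \<omega>)) * U \<omega>"
      using strong_solution_innovation_increment[OF X st, of w] by eventually_elim simp
  qed measurable
  also have "\<dots> = 0" by (rule increment_inner_orthogonal_past[OF st U])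
  finally show ?thesis .
qed

lemma innovation_covariance:
  fixes G :: "real ^ 'm ^ 'd"
  assumes X: "strong_solution M F W x0 A G X"
  shows "expectation (\<lambda>\<omega>. innovation A x0 w 1 (\<lambda>r. X r \<omega>) * innovation A x0 u 1 (\<lambda>r. X r \<omega>))
    = (w v* G) \<bullet> (u v* G)"
proof -
  have [measurable]: "(\<lambda>\<omega>. innovation A x0 w 1 (\<lambda>r. X r \<omega>)) \<in> borel_measurable M" for w
    by (auto intro: innovation_measurable[OF X])
  have [measurable]: "W 1 \<in> borel_measurable M" "W 0 \<in> borel_measurable M"
    by (auto intro: measurable_W)
  have "expectation (\<lambda>\<omega>. innovation A x0 w 1 (\<lambda>r. X r \<omega>) * innovation A x0 u 1 (\<lambda>r. X r \<omega>))
      = expectation (\<lambda>\<omega>. ((w v* G) \<bullet> (W 1 \<omega> - W 0 \<omega>)) * ((u v* G) \<bullet> (W 1 \<omega> - W 0 \<omega>)))"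
  proof (rule integral_cong_AE)
    show "AE \<omega> in M. innovation A x0 w 1 (\<lambda>r. X r \<omega>) * innovation A x0 u 1 (\<lambda>r. X r \<omega>)
        = ((w v* G) \<bullet> (W 1 \<omega> - W 0 \<omega>)) * ((u v* G) \<bullet> (W 1 \<omega> - W 0 \<omega>))"
      using strong_solution_innovation[OF X, of w] strong_solution_innovation[OF X, of u]
      by eventually_elim simp
  qed measurable
  also have "\<dots> = (w v* G) \<bullet> (u v* G)"
    by (subst increment_inner_covariance) auto
  finally show ?thesis .
qed

text \<open>Equality of the path laws in terms of expectations. The law only sees paths restricted to
  \<open>{0..}\<close>, whence the condition that \<open>\<Phi>\<close> ignores negative times.\<close>

lemma expectation_path_functional:
  fixes X Y :: "real \<Rightarrow> 'w \<Rightarrow> real ^ 'd" and \<Phi> :: "(real \<Rightarrow> real ^ 'd) \<Rightarrow> real"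
  assumes X: "strong_solution M F W x0 A G X" and Y: "strong_solution M F W x0' A' G' Y"
    and law: "path_law M X = path_law M Y"
    and \<Phi>: "\<Phi> \<in> borel_measurable (\<Pi>\<^sub>M t\<in>{0..}. borel)" "\<And>f. \<Phi> (restrict f {0..}) = \<Phi> f"
  shows "expectation (\<lambda>\<omega>. \<Phi> (\<lambda>t. X t \<omega>)) = expectation (\<lambda>\<omega>. \<Phi> (\<lambda>t. Y t \<omega>))"
    and "integrable M (\<lambda>\<omega>. \<Phi> (\<lambda>t. X t \<omega>)) \<longleftrightarrow> integrable M (\<lambda>\<omega>. \<Phi> (\<lambda>t. Y t \<omega>))"
  using integral_distr[OF measurable_path[OF X] \<Phi>(1)] integral_distr[OF measurable_path[OF Y] \<Phi>(1)]
    integrable_distr_eq[OF measurable_path[OF X] \<Phi>(1)] integrable_distr_eq[OF measurable_path[OF Y] \<Phi>(1)]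
    law
  by (simp_all add: path_law_def \<Phi>(2))

text \<open>If the solutions for \<open>(A, G)\<close> and \<open>(A', G')\<close> have the same law, then both innovations of
  the solution \<open>X\<close> have increments orthogonal to the past of \<open>X\<close>. Their difference
  \<open>\<integral>\<^sub>0\<^sup>t w \<bullet> (A' - A) X\<close> then has orthogonal increments and Lipschitz paths, so it vanishes.\<close>

lemma same_law_imp_drift_difference_zero:
  fixes X Y :: "real \<Rightarrow> 'w \<Rightarrow> real ^ 'd"
  assumes X: "strong_solution M F W x0 A G X" and Y: "strong_solution M F W x0 A' G' Y"
    and law: "path_law M X = path_law M Y"
  shows "AE \<omega> in M. \<forall>t\<ge>0. (w v* A' - w v* A) \<bullet> X t \<omega> = 0"
proof -
  define N where "N t f = innovation A x0 w t f" for t f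
  define N' where "N' t f = innovation A' x0 w t f" for t f
  define D where "D t \<omega> = N t (\<lambda>r. X r \<omega>) - N' t (\<lambda>r. X r \<omega>)" for t \<omega>
  let ?v = "w v* A' - w v* A"
  have contv: "continuous_on {0..} (\<lambda>t. ?v \<bullet> X t \<omega>)" if "\<omega> \<in> space M" for \<omega>
    by (intro continuous_intros strong_solution_continuous[OF X that])
  have D_eq: "D t \<omega> = integral {0..t} (\<lambda>s. ?v \<bullet> X s \<omega>)" if "\<omega> \<in> space M" "0 \<le> t" for t \<omega>
  proof -
    note c = strong_solution_continuous[OF X that(1)]
    have "integral {0..t} (\<lambda>s. (w v* A') \<bullet> X s \<omega> - (w v* A) \<bullet> X s \<omega>)
        = integral {0..t} (\<lambda>s. (w v* A') \<bullet> X s \<omega>) - integral {0..t} (\<lambda>s. (w v* A) \<bullet> X s \<omega>)"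
      by (intro integral_diff integrable_continuous_real continuous_intros continuous_on_subset[OF c]) auto
    then show ?thesis
      by (simp add: D_def N_def N'_def innovation_eq_integral[OF c that(2)] inner_diff_left)
  qed
  have D_F: "D s \<in> borel_measurable (F t)" if "0 \<le> s" "s \<le> t" for s t
    unfolding D_def N_def N'_def by (intro borel_measurable_diff innovation_adapted[OF X] that)
  have D_M: "D t \<in> borel_measurable M" if "0 \<le> t" for t
    using D_F[OF that order_refl] measurable_F_imp_measurable_M that by blast
  have N_path[measurable]: "N t \<in> borel_measurable (\<Pi>\<^sub>M t\<in>{0..}. borel)"
    "N' t \<in> borel_measurable (\<Pi>\<^sub>M t\<in>{0..}. borel)" if "0 \<le> t" for t
    using that measurable_innovation_path unfolding N_def[abs_def] N'_def[abs_def] by auto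
  have N_restrict: "N t (restrict f {0..}) = N t f" "N' t (restrict f {0..}) = N' t f" if "0 \<le> t" for t f
    using that by (simp_all add: N_def N'_def innovation_restrict)
  have N_M: "(\<lambda>\<omega>. N t (\<lambda>r. Z r \<omega>)) \<in> borel_measurable M" "(\<lambda>\<omega>. N' t (\<lambda>r. Z r \<omega>)) \<in> borel_measurable M"
    if "0 \<le> t" "strong_solution M F W x0 B K Z" for t B K and Z :: "real \<Rightarrow> 'w \<Rightarrow> real ^ 'd"
    unfolding N_def N'_def using innovation_measurable[OF that(2,1)] by auto
  obtain C where C:
    "\<And>s t. 0 \<le> s \<Longrightarrow> s \<le> t \<Longrightarrow> integrable M (\<lambda>\<omega>. (N t (\<lambda>r. X r \<omega>) - N s (\<lambda>r. X r \<omega>)) ^ 4)"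
    "\<And>s t. 0 \<le> s \<Longrightarrow> s \<le> t \<Longrightarrow> expectation (\<lambda>\<omega>. (N t (\<lambda>r. X r \<omega>) - N s (\<lambda>r. X r \<omega>)) ^ 4) \<le> C * (t - s)\<^sup>2"
    unfolding N_def using innovation_fourth_moment[OF X, of w] by blast
  obtain C' where C':
    "\<And>s t. 0 \<le> s \<Longrightarrow> s \<le> t \<Longrightarrow> integrable M (\<lambda>\<omega>. (N' t (\<lambda>r. Y r \<omega>) - N' s (\<lambda>r. Y r \<omega>)) ^ 4)"
    "\<And>s t. 0 \<le> s \<Longrightarrow> s \<le> t \<Longrightarrow> expectation (\<lambda>\<omega>. (N' t (\<lambda>r. Y r \<omega>) - N' s (\<lambda>r. Y r \<omega>)) ^ 4) \<le> C' * (t - s)\<^sup>2"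
    unfolding N'_def using innovation_fourth_moment[OF Y, of w] by blast
  have N'X: "integrable M (\<lambda>\<omega>. (N' t (\<lambda>r. X r \<omega>) - N' s (\<lambda>r. X r \<omega>)) ^ 4) \<and>
      expectation (\<lambda>\<omega>. (N' t (\<lambda>r. X r \<omega>) - N' s (\<lambda>r. X r \<omega>)) ^ 4) \<le> C' * (t - s)\<^sup>2"
    if st: "0 \<le> s" "s \<le> t" for s t
  proof -
    have "(\<lambda>f. (N' t f - N' s f) ^ 4) \<in> borel_measurable (\<Pi>\<^sub>M t\<in>{0..}. borel)"
      using st N_path by auto
    from expectation_path_functional[OF X Y law this] C'(1,2)[OF st] st
    show ?thesis by (simp add: N_restrict)
  qed
  have D4: "integrable M (\<lambda>\<omega>. (D t \<omega> - D s \<omega>) ^ 4) \<and>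
      expectation (\<lambda>\<omega>. (D t \<omega> - D s \<omega>) ^ 4) \<le> (8 * (C + C')) * (t - s)\<^sup>2"
    if st: "0 \<le> s" "s \<le> t" for s t
  proof -
    let ?a = "\<lambda>\<omega>. N t (\<lambda>r. X r \<omega>) - N s (\<lambda>r. X r \<omega>)"
    let ?b = "\<lambda>\<omega>. N' t (\<lambda>r. X r \<omega>) - N' s (\<lambda>r. X r \<omega>)"
    have le: "(D t \<omega> - D s \<omega>) ^ 4 \<le> 8 * (?a \<omega> ^ 4 + ?b \<omega> ^ 4)" for \<omega>
    proof -
      have eq: "D t \<omega> - D s \<omega> = ?a \<omega> - ?b \<omega>" by (simp add: D_def)
      show ?thesis unfolding eq by (rule power4_diff_le)
    qed
    have int: "integrable M (\<lambda>\<omega>. 8 * (?a \<omega> ^ 4 + ?b \<omega> ^ 4))"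
      using C(1)[OF st] N'X[OF st] by auto
    have int': "integrable M (\<lambda>\<omega>. (D t \<omega> - D s \<omega>) ^ 4)"
    proof (rule Bochner_Integration.integrable_bound[OF int])
      show "(\<lambda>\<omega>. (D t \<omega> - D s \<omega>) ^ 4) \<in> borel_measurable M"
        using st by (intro borel_measurable_power borel_measurable_diff D_M) auto
      show "AE \<omega> in M. norm ((D t \<omega> - D s \<omega>) ^ 4) \<le> norm (8 * (?a \<omega> ^ 4 + ?b \<omega> ^ 4))"
        using le by (intro AE_I2) (auto intro: order_trans[OF _ abs_ge_self])
    qed
    have "expectation (\<lambda>\<omega>. (D t \<omega> - D s \<omega>) ^ 4) \<le> expectation (\<lambda>\<omega>. 8 * (?a \<omega> ^ 4 + ?b \<omega> ^ 4))"
      by (intro integral_mono int int' le)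
    also have "\<dots> = 8 * (expectation (\<lambda>\<omega>. ?a \<omega> ^ 4) + expectation (\<lambda>\<omega>. ?b \<omega> ^ 4))"
      using C(1)[OF st] N'X[OF st] by simp
    also have "\<dots> \<le> 8 * (C * (t - s)\<^sup>2 + C' * (t - s)\<^sup>2)"
      using C(2)[OF st] N'X[OF st] by (intro mult_left_mono add_mono) auto
    finally show ?thesis using int' by (simp add: algebra_simps)
  qed
  have orth: "expectation (\<lambda>\<omega>. (D t \<omega> - D s \<omega>) * (D v \<omega> - D u \<omega>)) = 0"
    if le: "0 \<le> u" "u \<le> v" "v \<le> s" "s \<le> t" for u v s t
  proof -
    have s: "0 \<le> s" and v: "0 \<le> v" and t: "0 \<le> t" using le by auto
    let ?U = "\<lambda>f. (N v f - N' v f) - (N u f - N' u f)"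
    have U_eq: "D v \<omega> - D u \<omega> = ?U (\<lambda>r. X r \<omega>)" for \<omega> by (simp add: D_def)
    have U_meas: "(\<lambda>\<omega>. D v \<omega> - D u \<omega>) \<in> borel_measurable M"
      using le v by (intro borel_measurable_diff D_M)
    have U2: "integrable M (\<lambda>\<omega>. (D v \<omega> - D u \<omega>)\<^sup>2)"
      using D4[OF le(1,2)] by (intro integrable_power2_if_power4 U_meas) auto
    have U1: "integrable M (\<lambda>\<omega>. D v \<omega> - D u \<omega>)"
      by (rule integrable_if_power2[OF U_meas U2])
    have U_path: "?U \<in> borel_measurable (\<Pi>\<^sub>M t\<in>{0..}. borel)"
      using N_path[OF v] N_path[OF le(1)] by auto
    have a0: "expectation (\<lambda>\<omega>. (N t (\<lambda>r. X r \<omega>) - N s (\<lambda>r. X r \<omega>)) * (D v \<omega> - D u \<omega>)) = 0"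
      unfolding N_def using le v
      by (intro innovation_orthogonal_past[OF X s le(4)] U1 borel_measurable_diff D_F) auto
    \<comment> \<open>For the second innovation orthogonality is known along \<open>Y\<close>; the common law carries it over to \<open>X\<close>.\<close>
    have b0: "expectation (\<lambda>\<omega>. (N' t (\<lambda>r. X r \<omega>) - N' s (\<lambda>r. X r \<omega>)) * (D v \<omega> - D u \<omega>)) = 0"
    proof -
      have "(\<lambda>f. (N' t f - N' s f) * ?U f) \<in> borel_measurable (\<Pi>\<^sub>M t\<in>{0..}. borel)"
        using N_path[OF t] N_path[OF s] U_path by auto
      then have "expectation (\<lambda>\<omega>. (N' t (\<lambda>r. X r \<omega>) - N' s (\<lambda>r. X r \<omega>)) * ?U (\<lambda>r. X r \<omega>))
          = expectation (\<lambda>\<omega>. (N' t (\<lambda>r. Y r \<omega>) - N' s (\<lambda>r. Y r \<omega>)) * ?U (\<lambda>r. Y r \<omega>))"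
        by (rule expectation_path_functional[OF X Y law])
          (use le v s t in \<open>simp add: N_restrict\<close>)
      also have "\<dots> = 0"
      proof -
        have m: "(\<lambda>\<omega>. ?U (\<lambda>r. Y r \<omega>)) \<in> borel_measurable (F s)"
          unfolding N_def N'_def using le v
          by (intro borel_measurable_diff innovation_adapted[OF Y]) auto
        have "integrable M (\<lambda>\<omega>. ?U (\<lambda>r. X r \<omega>)) \<longleftrightarrow> integrable M (\<lambda>\<omega>. ?U (\<lambda>r. Y r \<omega>))"
          by (rule expectation_path_functional[OF X Y law U_path])
            (use le v in \<open>simp add: N_restrict\<close>)
        then have i: "integrable M (\<lambda>\<omega>. ?U (\<lambda>r. Y r \<omega>))"
          using U1 by (simp add: U_eq)
        show ?thesis
          by (rule innovation_orthogonal_past[OF Y s le(4) m i, of w, folded N'_def])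
      qed
      finally show ?thesis by (simp add: U_eq)
    qed
    have inta: "integrable M (\<lambda>\<omega>. (N t (\<lambda>r. X r \<omega>) - N s (\<lambda>r. X r \<omega>)) * (D v \<omega> - D u \<omega>))"
      using C(1)[OF s le(4)] N_M(1)[OF t X] N_M(1)[OF s X]
      by (intro integrable_mult_if_power2 integrable_power2_if_power4 U_meas U2 borel_measurable_diff) auto
    have intb: "integrable M (\<lambda>\<omega>. (N' t (\<lambda>r. X r \<omega>) - N' s (\<lambda>r. X r \<omega>)) * (D v \<omega> - D u \<omega>))"
      using N'X[OF s le(4)] N_M(2)[OF t X] N_M(2)[OF s X]
      by (intro integrable_mult_if_power2 integrable_power2_if_power4 U_meas U2 borel_measurable_diff) auto
    have "(\<lambda>\<omega>. (D t \<omega> - D s \<omega>) * (D v \<omega> - D u \<omega>)) =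
        (\<lambda>\<omega>. (N t (\<lambda>r. X r \<omega>) - N s (\<lambda>r. X r \<omega>)) * (D v \<omega> - D u \<omega>)
          - (N' t (\<lambda>r. X r \<omega>) - N' s (\<lambda>r. X r \<omega>)) * (D v \<omega> - D u \<omega>))"
      by (rule ext) (simp add: D_def algebra_simps)
    then show ?thesis
      using Bochner_Integration.integral_diff[OF inta intb] a0 b0 by simp
  qed
  have D0: "AE \<omega> in M. D T \<omega> = 0" if T: "0 \<le> T" for T
  proof -
    have "AE \<omega> in M. D T \<omega> = D 0 \<omega>"
    proof (rule orthogonal_increments_lipschitz_constant[where C = "8 * (C + C')"])
      show "AE \<omega> in M. \<exists>K. \<forall>s\<in>{0..T}. \<forall>t\<in>{0..T}. \<bar>D t \<omega> - D s \<omega>\<bar> \<le> K * \<bar>t - s\<bar>"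
      proof (rule AE_I2)
        fix \<omega> assume \<omega>: "\<omega> \<in> space M"
        from lipschitz_integral[OF contv[OF \<omega>], of T]
        show "\<exists>K. \<forall>s\<in>{0..T}. \<forall>t\<in>{0..T}. \<bar>D t \<omega> - D s \<omega>\<bar> \<le> K * \<bar>t - s\<bar>"
          using D_eq[OF \<omega>] by simp
      qed
    qed (use D4 orth D_M T in auto)
    then show ?thesis
      using AE_space by eventually_elim (simp add: D_eq)
  qed
  \<comment> \<open>The exceptional null set of \<open>D T = 0\<close> depends on \<open>T\<close>: take countably many times, then use continuity.\<close>
  have "AE \<omega> in M. \<forall>k n :: nat. D (real k / real n) \<omega> = 0"
    unfolding AE_all_countable by (intro allI D0) simp
  then show ?thesis
    using AE_space
  proof eventually_elim
    case (elim \<omega>)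
    note c = contv[OF elim(2)]
    have "integral {0..t} (\<lambda>s. ?v \<bullet> X s \<omega>) = 0" if "0 \<le> t" for t
    proof (rule zero_on_fractions_imp_zero[OF continuous_on_indefinite_integral[OF c] _ that])
      fix k n :: nat
      show "integral {0..real k / real n} (\<lambda>s. ?v \<bullet> X s \<omega>) = 0"
        using elim(1) D_eq[OF elim(2), of "real k / real n"] by simp
    qed
    then show ?case using integral_zero_imp_zero[OF c] by blast
  qed
qed

text \<open>If \<open>v\<close> annihilates the solution, then the integral equation shows that the Brownian part
  \<open>v \<bullet> G (W t - W 0)\<close> has Lipschitz paths, which forces \<open>v\<^sup>T G = 0\<close>.\<close>

lemma annihilator_step:
  fixes X :: "real \<Rightarrow> 'w \<Rightarrow> real ^ 'd"
  assumes X: "strong_solution M F W x0 A G X" and v: "AE \<omega> in M. \<forall>t\<ge>0. v \<bullet> X t \<omega> = 0"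
  shows "v \<bullet> x0 = 0" "v v* G = 0" "AE \<omega> in M. \<forall>t\<ge>0. (v v* A) \<bullet> X t \<omega> = 0"
proof -
  let ?c = "v v* G"
  have eq: "AE \<omega> in M. \<forall>t\<ge>0. v \<bullet> x0 + integral {0..t} (\<lambda>s. (v v* A) \<bullet> X s \<omega>) + ?c \<bullet> (W t \<omega> - W 0 \<omega>) = 0"
    using strong_solution_inner[OF X] v by eventually_elim metis
  then have "AE \<omega> in M. v \<bullet> x0 = 0"
    by eventually_elim (auto dest!: spec[of _ 0])
  then show x0: "v \<bullet> x0 = 0" by simp
  have contv: "continuous_on {0..} (\<lambda>t. (v v* A) \<bullet> X t \<omega>)" if "\<omega> \<in> space M" for \<omega>
    by (intro continuous_intros strong_solution_continuous[OF X that])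
  define D where "D t \<omega> = ?c \<bullet> (W t \<omega> - W 0 \<omega>)" for t \<omega>
  have D_diff: "D t \<omega> - D s \<omega> = ?c \<bullet> (W t \<omega> - W s \<omega>)" for s t \<omega>
    by (simp add: D_def inner_diff_right)
  have "AE \<omega> in M. D 1 \<omega> = D 0 \<omega>"
  proof (rule orthogonal_increments_lipschitz_constant[where C = "3 * (?c \<bullet> ?c)\<^sup>2 * (real CARD('m))\<^sup>2"])
    show "D t \<in> borel_measurable M" if "0 \<le> t" for t
      unfolding D_def using that
      by (intro borel_measurable_inner borel_measurable_const borel_measurable_diff measurable_W) auto
    show "expectation (\<lambda>\<omega>. (D t \<omega> - D s \<omega>) * (D v \<omega> - D u \<omega>)) = 0"
      if le: "0 \<le> u" "u \<le> v" "v \<le> s" "s \<le> t" for u v s t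
      unfolding D_diff
    proof (rule increment_inner_orthogonal_past)
      have "W v \<in> borel_measurable (F s)" "W u \<in> borel_measurable (F s)"
        using le by (auto intro: measurable_F_mono[OF _ _ adapted])
      then show m: "(\<lambda>\<omega>. ?c \<bullet> (W v \<omega> - W u \<omega>)) \<in> borel_measurable (F s)"
        by (intro borel_measurable_inner borel_measurable_const borel_measurable_diff)
      have m': "(\<lambda>\<omega>. ?c \<bullet> (W v \<omega> - W u \<omega>)) \<in> borel_measurable M"
        using le by (intro measurable_F_imp_measurable_M[OF _ m]) simp
      show "integrable M (\<lambda>\<omega>. ?c \<bullet> (W v \<omega> - W u \<omega>))"
        by (rule integrable_if_power2[OF m' integrable_power2_if_power4[OF m'
              increment_inner_fourth_moment(1)[OF le(1,2)]]])
    qed (use le in auto)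
    show "AE \<omega> in M. \<exists>K. \<forall>s\<in>{0..1}. \<forall>t\<in>{0..1}. \<bar>D t \<omega> - D s \<omega>\<bar> \<le> K * \<bar>t - s\<bar>"
      using eq AE_space
    proof eventually_elim
      case (elim \<omega>)
      have D: "D t \<omega> = - integral {0..t} (\<lambda>s. (v v* A) \<bullet> X s \<omega>)" if "0 \<le> t" for t
        using elim(1) that x0 by (auto simp: D_def)
      from lipschitz_integral[OF contv[OF elim(2)], of 1]
      obtain K where K: "\<forall>s\<in>{0..1}. \<forall>t\<in>{0..1}.
          \<bar>integral {0..t} (\<lambda>s. (v v* A) \<bullet> X s \<omega>) - integral {0..s} (\<lambda>s. (v v* A) \<bullet> X s \<omega>)\<bar> \<le> K * \<bar>t - s\<bar>"
        by blast
      have "\<bar>D t \<omega> - D s \<omega>\<bar> \<le> K * \<bar>t - s\<bar>" if "s \<in> {0..1}" "t \<in> {0..1}" for s t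
      proof -
        have "\<bar>D t \<omega> - D s \<omega>\<bar> =
            \<bar>integral {0..t} (\<lambda>s. (v v* A) \<bullet> X s \<omega>) - integral {0..s} (\<lambda>s. (v v* A) \<bullet> X s \<omega>)\<bar>"
          using D[of s] D[of t] that by simp
        then show ?thesis using K that by auto
      qed
      then show ?case by blast
    qed
  qed (unfold D_diff, auto intro: increment_inner_fourth_moment)
  then have "AE \<omega> in M. (?c \<bullet> (W 1 \<omega> - W 0 \<omega>)) * (?c \<bullet> (W 1 \<omega> - W 0 \<omega>)) = 0"
    by eventually_elim (simp add: D_def)
  moreover have "(\<lambda>\<omega>. (?c \<bullet> (W 1 \<omega> - W 0 \<omega>)) * (?c \<bullet> (W 1 \<omega> - W 0 \<omega>))) \<in> borel_measurable M"
    by (intro borel_measurable_times borel_measurable_inner borel_measurable_const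
        borel_measurable_diff measurable_W) auto
  ultimately have "expectation (\<lambda>\<omega>. (?c \<bullet> (W 1 \<omega> - W 0 \<omega>)) * (?c \<bullet> (W 1 \<omega> - W 0 \<omega>))) = expectation (\<lambda>\<omega>. 0)"
    by (intro integral_cong_AE) auto
  then show c: "?c = 0"
    using increment_inner_covariance[of 0 1 ?c ?c] by simp
  show "AE \<omega> in M. \<forall>t\<ge>0. (v v* A) \<bullet> X t \<omega> = 0"
    using eq AE_space
  proof eventually_elim
    case (elim \<omega>)
    have "integral {0..t} (\<lambda>s. (v v* A) \<bullet> X s \<omega>) = 0" if "0 \<le> t" for t
      using elim(1) that x0 c by simp
    then show ?case using integral_zero_imp_zero[OF contv[OF elim(2)]] by blast
  qed
qed

text \<open>Iterating the last part of the previous lemma gives all powers of \<open>A\<close>.\<close>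

lemma annihilator_orthogonal_krylov:
  fixes X :: "real \<Rightarrow> 'w \<Rightarrow> real ^ 'd"
  assumes X: "strong_solution M F W x0 A G X" and v: "AE \<omega> in M. \<forall>t\<ge>0. v \<bullet> X t \<omega> = 0"
  shows "(v v* matpow A k) \<bullet> x0 = 0" "(v v* matpow A k) v* G = 0"
proof -
  have "AE \<omega> in M. \<forall>t\<ge>0. (v v* matpow A k) \<bullet> X t \<omega> = 0"
  proof (induction k)
    case (Suc k)
    from annihilator_step(3)[OF X this] show ?case
      by (simp add: vector_matrix_mul_assoc matpow_Suc_right)
  qed (use v in simp)
  from annihilator_step(1,2)[OF X this]
  show "(v v* matpow A k) \<bullet> x0 = 0" "(v v* matpow A k) v* G = 0" .
qed

text \<open>The drift is determined since every row of \<open>A' - A\<close> annihilates the solution. With the same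
  drift, the innovation is the same functional for both processes, and its covariance at time \<open>1\<close>
  is \<open>G G\<^sup>T\<close>.\<close>

lemma full_rank_same_law_imp_eq:
  fixes x0 :: "real ^ 'd" and A A' :: "real ^ 'd ^ 'd" and G G' :: "real ^ 'm ^ 'd"
  assumes rank: "rank (krylov_matrix A x0 (G ** transpose G)) = CARD('d)"
    and law: "path_law M (sde_solution M F W x0 A G) = path_law M (sde_solution M F W x0 A' G')"
  shows "A = A'" "G ** transpose G = G' ** transpose G'"
proof -
  let ?X = "sde_solution M F W x0 A G" and ?Y = "sde_solution M F W x0 A' G'"
  note X = strong_solution_sde_solution[of x0 A G]
  note Y = strong_solution_sde_solution[of x0 A' G']
  have "w v* A' - w v* A = 0" for w
    using annihilator_orthogonal_krylov[OF X same_law_imp_drift_difference_zero[OF X Y law]]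
      rank[unfolded rank_krylov_matrix_full_iff] by blast
  then have "w \<bullet> (A *v x) = w \<bullet> (A' *v x)" for w x
    by (metis dot_lmul_matrix eq_iff_diff_eq_0)
  then have "A *v x = A' *v x" for x
    by (metis vector_eq_rdot inner_commute)
  then show eq: "A = A'" by (metis matrix_eq)
  have cov: "(w v* G) \<bullet> (u v* G) = (w v* G') \<bullet> (u v* G')" for w u
  proof -
    have "(\<lambda>f. innovation A x0 w 1 f * innovation A x0 u 1 f) \<in> borel_measurable (\<Pi>\<^sub>M t\<in>{0..}. borel)"
      by (intro borel_measurable_times measurable_innovation_path) auto
    from expectation_path_functional(1)[OF X Y law this]
    have "expectation (\<lambda>\<omega>. innovation A x0 w 1 (\<lambda>r. ?X r \<omega>) * innovation A x0 u 1 (\<lambda>r. ?X r \<omega>))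
        = expectation (\<lambda>\<omega>. innovation A x0 w 1 (\<lambda>r. ?Y r \<omega>) * innovation A x0 u 1 (\<lambda>r. ?Y r \<omega>))"
      by (simp add: innovation_restrict)
    then show ?thesis
      using innovation_covariance[OF X, of w u] innovation_covariance[OF Y, of w u] eq by simp
  qed
  have "w \<bullet> ((K ** transpose K) *v u) = (w v* K) \<bullet> (u v* K)" for w u and K :: "real ^ 'm ^ 'd"
    by (simp add: matrix_vector_mul_assoc[symmetric] dot_lmul_matrix)
  then have "(G ** transpose G) *v u = (G' ** transpose G') *v u" for u
    using cov by (metis vector_eq_rdot inner_commute)
  then show "G ** transpose G = G' ** transpose G'" by (metis matrix_eq)
qed

end

theorem theorem3p4:
  fixes M :: "'w measure" and F :: "real \<Rightarrow> 'w measure"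
    and W :: "real \<Rightarrow> 'w \<Rightarrow> real ^ 'm"
    and x0 :: "real ^ 'd" and A :: "real ^ 'd ^ 'd" and G :: "real ^ 'm ^ 'd"
  assumes "standard_brownian_motion M F W"
    and "card (complex_eigenvalues A) = CARD('d)"
  shows "generator_identifiable M F W x0 A G \<longleftrightarrow>
    rank (krylov_matrix A x0 (G ** transpose G)) = CARD('d)"
proof
  interpret standard_brownian_motion M F W by fact
  show "rank (krylov_matrix A x0 (G ** transpose G)) = CARD('d)"
    if "generator_identifiable M F W x0 A G"
  proof (rule ccontr)
    assume "rank (krylov_matrix A x0 (G ** transpose G)) \<noteq> CARD('d)"
    then obtain w where "w \<noteq> 0" "\<And>k. (w v* matpow A k) \<bullet> x0 = 0" "\<And>k. (w v* matpow A k) v* G = 0"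
      unfolding rank_krylov_matrix_full_iff by blast
    then obtain A' where "A' \<noteq> A"
      "path_law M (sde_solution M F W x0 A G) = path_law M (sde_solution M F W x0 A' G)"
      by (rule rank_deficient_imp_same_law)
    moreover from \<open>A' \<noteq> A\<close> have "(A, G ** transpose G) \<noteq> (A', G ** transpose G)" by simp
    ultimately show False using that unfolding generator_identifiable_def by metis
  qed
  show "generator_identifiable M F W x0 A G"
    if "rank (krylov_matrix A x0 (G ** transpose G)) = CARD('d)"
    unfolding generator_identifiable_def using full_rank_same_law_imp_eq[OF that] by blast
qed

end
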